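(* Assume that $R^\mu$ and $C_0^\mu$ are range-equivalent. Define the scalar random variables $$W_{tj}:=\langle F_t-\mathbb{E}F_0,\psi_j\rangle,\qquad j\in\mathbb{N},\ t=0,1,\dots$$ If $\mu$ is a diffraction of $(\xi_t)$, then: (i) $\mathbb{E}W_{tj}=0$ for all $t$ and all $j$; (ii) $\mathrm{Var}(W_{tj})=\sum_{i=1}^\infty\lambda_i\langle\psi_j,\varphi_i\rangle^2$ for all $t$ and all $j$; (iii) for each $j$, the function $\psi_j$ is bounded. Moreover, for each $t$ the expansion $$F_t=\mathbb{E}F_0+\sum_{j=1}^\infty W_{tj}\psi_j$$ holds in $L^2(\mu)$, almost surely.
   Context: Let $(\Omega,\mathscr{A},\mathbb{P})$ be a probability space and $M_1(\mathbb{R})$ the set of Borel probability measures on $\mathbb{R}$ with the topology of weak convergence. Standing assumption: $(\xi_t:t=0,1,\dots)$ is a stationary sequence of random elements of $M_1(\mathbb{R})$. The baricenter $\mathbb{E}\xi_0$ is the unique element of $M_1(\mathbb{R})$ with $\mathbb{E}\int f\,d\xi_0=\int f\,d\mathbb{E}\xi_0$ for all continuous bounded $f$. A finite Borel measure $\mu$ on $\mathbb{R}$ is a diffraction of $(\xi_t)$ if it is equivalent to Lebesgue measure on some interval containing the support of $\mathbb{E}\xi_0$. $\langle\cdot,\cdot\rangle$ is the inner product of $L^2(\mu)$. For $x,y\in\mathbb{R}$ put $F_t(x):=\xi_t(-\infty,x]$, $\mathbb{E}F_0(x):=\mathbb{E}\xi_0(-\infty,x]$, and for $k=0,1,\dots$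 put $C_k(x,y):=\mathrm{Cov}(F_0(x),F_k(y))$ and $C_k^\mu f(x):=\int C_k(x,y)f(y)\,\mu(dy)$ on $L^2(\mu)$. Let $(\lambda_j:j\in\mathbb{N})$ be the non-increasing sequence of eigenvalues of the positive trace-class operator $C_0^\mu$ (with repetitions, if any; it contains zeros if and only if $C_0^\mu$ has finite rank), with $L^2(\mu)$-orthonormal eigenfunctions $\varphi_j$, $C_0^\mu\varphi_j=\lambda_j\varphi_j$, $j\in\mathbb{N}$. Fix an integer $p\ge1$. $R^\mu$ is the positive integral operator on $L^2(\mu)$ with kernel $R_\mu(x,y):=\sum_{k=1}^p\int C_k(x,z)C_k(y,z)\,\mu(dz)$, i.e. $R^\mu=\sum_{k=1}^pC_k^\mu C_k^{\mu*}$. Let $(\theta_j:j\in\mathbb{N})$ be the non-increasing sequence of its eigenvalues (with repetitions, if any; it contains zeros if and only if $R^\mu$ has finite rank), with $L^2(\mu)$-orthonormal eigenfunctions $\psi_j$, $R^\mu\psi_j=\theta_j\psi_j$, $j\in\mathbb{N}$. Two operators $T,S$ on $L^2(\mu)$ are range-equivalent if $\overline{\mathrm{Ran}(T)}=\overline{\mathrm{Ran}(S)}$.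
   Formalization: Part (iii), boundedness of ψ_j, is stated only for j with θ_j ≠ 0: if R^μ has finite rank, the ψ_j with θ_j = 0 are arbitrary orthonormal elements of its kernel and can be unbounded, so the claim for every j fails. *)

theory Defs
  imports "HOL-Probability.Probability"
begin

section \<open>Random probability measures on the real line\<close>

text \<open>The set of Borel probability measures on the reals is \<open>{\<nu>. real_distribution \<nu>}\<close>.
  Weak convergence is the coarsest topology on it that makes \<open>\<nu> \<mapsto> \<integral>f d\<nu>\<close> continuous for every
  bounded continuous \<open>f\<close>.\<close>

definition weak_topology :: "real measure topology" where
  "weak_topology = topology_generated_by
     {{\<nu>. real_distribution \<nu> \<and> (\<integral>x. f x \<partial>\<nu>) \<in> U} | (f :: real \<Rightarrow> real) U.
        continuous_on UNIV f \<and> bounded (range f) \<and> open U}"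

definition weak_borel :: "real measure measure" where
  "weak_borel = sigma (topspace weak_topology) {U. openin weak_topology U}"

text \<open>Stationarity: all time shifts of the sequence have the same law on the sequence space.\<close>

definition stationary :: "'a measure \<Rightarrow> 'b measure \<Rightarrow> (nat \<Rightarrow> 'a \<Rightarrow> 'b) \<Rightarrow> bool" where
  "stationary M N X \<longleftrightarrow>
     (\<forall>t. X t \<in> measurable M N) \<and>
     (\<forall>s. distr M (PiM UNIV (\<lambda>_. N)) (\<lambda>\<omega> t. X (t + s) \<omega>) =
          distr M (PiM UNIV (\<lambda>_. N)) (\<lambda>\<omega> t. X t \<omega>))"

definition baricenter :: "'a measure \<Rightarrow> ('a \<Rightarrow> real measure) \<Rightarrow> real measure" where
  "baricenter M X = (THE \<nu>. real_distribution \<nu> \<and>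
     (\<forall>f :: real \<Rightarrow> real. continuous_on UNIV f \<and> bounded (range f) \<longrightarrow>
        (\<integral>\<omega>. (\<integral>x. f x \<partial>X \<omega>) \<partial>M) = (\<integral>x. f x \<partial>\<nu>)))"

definition measure_support :: "real measure \<Rightarrow> real set" where
  "measure_support \<nu> = {x. \<forall>U. open U \<and> x \<in> U \<longrightarrow> emeasure \<nu> U > 0}"

text \<open>Equivalence of measures is mutual absolute continuity; Lebesgue measure on an interval \<open>I\<close>
  is viewed as a measure on the whole line that vanishes off \<open>I\<close>. Intervals may be unbounded.\<close>

definition diffraction :: "'a measure \<Rightarrow> (nat \<Rightarrow> 'a \<Rightarrow> real measure) \<Rightarrow> real measure \<Rightarrow> bool" where
  "diffraction M \<xi> \<mu> \<longleftrightarrow> finite_borel_measure \<mu> \<and>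
     (\<exists>I. is_interval I \<and> measure_support (baricenter M (\<xi> 0)) \<subseteq> I \<and>
        absolutely_continuous \<mu> (density lborel (indicator I)) \<and>
        absolutely_continuous (density lborel (indicator I)) \<mu>)"

definition covariance :: "'a measure \<Rightarrow> ('a \<Rightarrow> real) \<Rightarrow> ('a \<Rightarrow> real) \<Rightarrow> real" where
  "covariance M X Y =
     (\<integral>\<omega>. (X \<omega> - (\<integral>\<omega>'. X \<omega>' \<partial>M)) * (Y \<omega> - (\<integral>\<omega>'. Y \<omega>' \<partial>M)) \<partial>M)"

definition autocov :: "'a measure \<Rightarrow> (nat \<Rightarrow> 'a \<Rightarrow> real measure) \<Rightarrow> nat \<Rightarrow> real \<Rightarrow> real \<Rightarrow> real" where
  "autocov M \<xi> k x y = covariance M (\<lambda>\<omega>. cdf (\<xi> 0 \<omega>) x) (\<lambda>\<omega>. cdf (\<xi> k \<omega>) y)"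


section \<open>Operators on the Hilbert space of square-integrable functions\<close>

text \<open>Elements of \<open>L\<^sup>2(\<mu>)\<close> are represented by square-integrable functions; equality in
  \<open>L\<^sup>2(\<mu>)\<close> is equality \<open>\<mu>\<close>-almost everywhere.\<close>

definition L2 :: "real measure \<Rightarrow> (real \<Rightarrow> real) set" where
  "L2 \<mu> = {f. f \<in> borel_measurable \<mu> \<and> integrable \<mu> (\<lambda>x. (f x)\<^sup>2)}"

definition L2_inner :: "real measure \<Rightarrow> (real \<Rightarrow> real) \<Rightarrow> (real \<Rightarrow> real) \<Rightarrow> real" where
  "L2_inner \<mu> f g = (\<integral>x. f x * g x \<partial>\<mu>)"

definition L2_norm :: "real measure \<Rightarrow> (real \<Rightarrow> real) \<Rightarrow> real" where
  "L2_norm \<mu> f = sqrt (L2_inner \<mu> f f)"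

definition L2_closure :: "real measure \<Rightarrow> (real \<Rightarrow> real) set \<Rightarrow> (real \<Rightarrow> real) set" where
  "L2_closure \<mu> A = {g \<in> L2 \<mu>. \<forall>\<epsilon>>0. \<exists>h\<in>A. L2_norm \<mu> (\<lambda>x. g x - h x) < \<epsilon>}"

definition range_equivalent ::
  "real measure \<Rightarrow> ((real \<Rightarrow> real) \<Rightarrow> (real \<Rightarrow> real)) \<Rightarrow> ((real \<Rightarrow> real) \<Rightarrow> (real \<Rightarrow> real)) \<Rightarrow> bool" where
  "range_equivalent \<mu> T S \<longleftrightarrow> L2_closure \<mu> (T ` L2 \<mu>) = L2_closure \<mu> (S ` L2 \<mu>)"

definition finite_rank :: "real measure \<Rightarrow> ((real \<Rightarrow> real) \<Rightarrow> (real \<Rightarrow> real)) \<Rightarrow> bool" where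
  "finite_rank \<mu> T \<longleftrightarrow> (\<exists>B. finite B \<and> B \<subseteq> L2 \<mu> \<and>
     (\<forall>f\<in>L2 \<mu>. \<exists>a. AE x in \<mu>. T f x = (\<Sum>b\<in>B. a b * b x)))"

definition kernel_op :: "real measure \<Rightarrow> (real \<Rightarrow> real \<Rightarrow> real) \<Rightarrow> (real \<Rightarrow> real) \<Rightarrow> real \<Rightarrow> real" where
  "kernel_op \<mu> K f = (\<lambda>x. \<integral>y. K x y * f y \<partial>\<mu>)"

text \<open>\<open>e\<close> is the non-increasing sequence of eigenvalues of \<open>T\<close>, repeated according to
  multiplicity, with orthonormal eigenfunctions \<open>\<phi>\<close>. The fifth conjunct says that every nonzero
  eigenvalue \<open>c\<close> is listed with its full multiplicity: the eigenspace of \<open>c\<close> is spanned by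
  the \<open>\<phi> j\<close> with \<open>e j = c\<close>. No such requirement is made for the eigenvalue zero, so \<open>\<phi>\<close> need
  not be complete in \<open>L\<^sup>2(\<mu>)\<close>.\<close>

definition eigen_sequence ::
  "real measure \<Rightarrow> ((real \<Rightarrow> real) \<Rightarrow> (real \<Rightarrow> real)) \<Rightarrow> (nat \<Rightarrow> real) \<Rightarrow> (nat \<Rightarrow> real \<Rightarrow> real) \<Rightarrow> bool" where
  "eigen_sequence \<mu> T e \<phi> \<longleftrightarrow>
     decseq e \<and>
     (\<forall>j. \<phi> j \<in> L2 \<mu>) \<and>
     (\<forall>i j. L2_inner \<mu> (\<phi> i) (\<phi> j) = (if i = j then 1 else 0)) \<and>
     (\<forall>j. AE x in \<mu>. T (\<phi> j) x = e j * \<phi> j x) \<and>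
     (\<forall>c f. c \<noteq> 0 \<and> f \<in> L2 \<mu> \<and> (AE x in \<mu>. T f x = c * f x) \<longrightarrow>
        (\<exists>J a. finite J \<and> J \<subseteq> {j. e j = c} \<and> (AE x in \<mu>. f x = (\<Sum>j\<in>J. a j * \<phi> j x)))) \<and>
     ((\<exists>j. e j = 0) \<longleftrightarrow> finite_rank \<mu> T)"

definition R_kernel ::
  "'a measure \<Rightarrow> (nat \<Rightarrow> 'a \<Rightarrow> real measure) \<Rightarrow> real measure \<Rightarrow> nat \<Rightarrow> real \<Rightarrow> real \<Rightarrow> real" where
  "R_kernel M \<xi> \<mu> p x y = (\<Sum>k=1..p. \<integral>z. autocov M \<xi> k x z * autocov M \<xi> k y z \<partial>\<mu>)"

end

theory Submission
  imports Defs
begin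

text \<open>Write \<open>X\<^sub>t = F\<^sub>t - EF\<^sub>0\<close> for the random deviations, viewed in \<open>L\<^sup>2(\<mu>)\<close>, and \<open>C\<close> for the
  covariance operator at lag zero, so that \<open>\<langle>Cu, u\<rangle> = E\<langle>X\<^sub>t, u\<rangle>\<^sup>2\<close> for every \<open>t\<close> by stationarity. The
  scores are \<open>W\<^sub>t\<^sub>j = \<langle>X\<^sub>t, \<psi>\<^sub>j\<rangle>\<close>; their mean vanishes by Fubini's theorem and their variance is
  \<open>\<langle>C\<psi>\<^sub>j, \<psi>\<^sub>j\<rangle>\<close>. An eigenfunction with nonzero eigenvalue is a multiple of its image under an operator
  with bounded kernel on a finite measure space, hence it is bounded.

  The sum formula for the variance and the expansion rest on the spectral theorem for compact
  positive operators, in the following form. If \<open>e\<^sub>n\<close> are the eigenvalues in decreasing order, then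
  \<open>\<langle>Tg, g\<rangle> \<le> e\<^sub>n\<langle>g, g\<rangle>\<close> whenever \<open>g\<close> is orthogonal to the first \<open>n\<close> eigenfunctions (\<open>rayleigh_le\<close>),
  and \<open>e\<^sub>n \<rightarrow> 0\<close>. Consequently \<open>\<langle>Tf, f\<rangle> = \<Sum>\<^sub>i e\<^sub>i\<langle>f, \<phi>\<^sub>i\<rangle>\<^sup>2\<close> (\<open>inner_T_eigen_sum\<close>), and the Fourier
  series along the eigenfunctions converges on the closure of the range (\<open>remainder_tendsto_0\<close>).
  Compactness of the covariance operators comes from Helly's selection theorem
  (\<open>pairing_adj_compact\<close>): the functions \<open>x \<mapsto> E[F\<^sub>t(x) Z]\<close> with \<open>Z \<ge> 0\<close> are increasing, so bounded
  sequences of them have subsequences that converge off a countable set, and a diffraction measure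
  has no atoms.

  It remains to see that \<open>X\<^sub>t\<close> almost surely lies in the closure of the range of \<open>C\<close>, which is the
  closure of the range of \<open>R\<close> by range-equivalence (\<open>AE_dev_in_closure_range\<close>). For bounded \<open>Z\<close> the
  function \<open>h = E[X\<^sub>t Z]\<close> satisfies \<open>\<langle>h, u\<rangle>\<^sup>2 \<le> c\<langle>Cu, u\<rangle>\<close> and therefore lies in that closure
  (\<open>in_closure_range\<close>). On the other hand, almost every path \<open>X\<^sub>t(\<omega>)\<close> is the limit of the conditional
  means of \<open>X\<^sub>t\<close> given the events that \<open>F\<^sub>t\<close> agrees with \<open>F\<^sub>t(\<omega>)\<close> up to rounding on finer and finer
  grids; almost surely all of these events have positive probability (\<open>dev_approximable\<close>).\<close>

section \<open>Square-integrable functions on a finite measure\<close>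

text \<open>The functions in \<open>L2 \<mu>\<close> form a real vector space on which \<open>L2_inner \<mu>\<close> is a
  positive semidefinite form; the functions of norm zero are those that vanish almost everywhere.\<close>

locale finite_L2 = finite_measure \<mu> for \<mu> :: "real measure"
begin

lemma L2_D:
  assumes "f \<in> L2 \<mu>"
  shows "f \<in> borel_measurable \<mu>" "integrable \<mu> (\<lambda>x. (f x)\<^sup>2)"
  using assms by (auto simp: L2_def)

lemma L2_mult_integrable:
  assumes "f \<in> L2 \<mu>" "g \<in> L2 \<mu>"
  shows "integrable \<mu> (\<lambda>x. f x * g x)"
proof (rule Bochner_Integration.integrable_bound)
  show "integrable \<mu> (\<lambda>x. (f x)\<^sup>2 + (g x)\<^sup>2)"
    using assms by (auto simp: L2_def)
  show "(\<lambda>x. f x * g x) \<in> borel_measurable \<mu>"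
    using assms by (auto simp: L2_def)
  have "\<bar>a * b\<bar> \<le> a\<^sup>2 + b\<^sup>2" for a b :: real
    using sum_squares_bound[of "\<bar>a\<bar>" "\<bar>b\<bar>"] mult_nonneg_nonneg[OF abs_ge_zero[of a] abs_ge_zero[of b]]
    unfolding abs_mult power2_abs by linarith
  then show "AE x in \<mu>. norm (f x * g x) \<le> norm ((f x)\<^sup>2 + (g x)\<^sup>2)"
    by auto
qed

lemma L2_bounded:
  assumes "f \<in> borel_measurable \<mu>" "AE x in \<mu>. \<bar>f x\<bar> \<le> c"
  shows "f \<in> L2 \<mu>"
proof -
  have "AE x in \<mu>. norm ((f x)\<^sup>2) \<le> c\<^sup>2"
    using assms(2) by eventually_elim (auto simp: abs_le_square_iff[symmetric])
  then show ?thesis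
    unfolding L2_def using assms(1) by (auto intro!: integrable_const_bound[where B="c\<^sup>2"])
qed

lemma L2_integrable: "f \<in> L2 \<mu> \<Longrightarrow> integrable \<mu> f"
  using L2_mult_integrable[of f "\<lambda>_. 1"] L2_bounded[of "\<lambda>_. 1" 1] by simp

lemma L2_bounded_mult:
  assumes "f \<in> L2 \<mu>" "g \<in> borel_measurable \<mu>" "AE x in \<mu>. \<bar>g x\<bar> \<le> c"
  shows "integrable \<mu> (\<lambda>x. g x * f x)"
  using L2_mult_integrable[OF L2_bounded[OF assms(2,3)] assms(1)] .

lemma L2_scale: "f \<in> L2 \<mu> \<Longrightarrow> (\<lambda>x. c * f x) \<in> L2 \<mu>"
  by (auto simp: L2_def power_mult_distrib)

lemma L2_add:
  assumes "f \<in> L2 \<mu>" "g \<in> L2 \<mu>"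
  shows "(\<lambda>x. f x + g x) \<in> L2 \<mu>"
proof -
  have "integrable \<mu> (\<lambda>x. (f x)\<^sup>2 + (g x)\<^sup>2 + 2 * (f x * g x))"
    using assms L2_mult_integrable[OF assms] by (auto simp: L2_def)
  moreover have "(\<lambda>x. f x + g x) \<in> borel_measurable \<mu>"
    using assms by (auto simp: L2_def)
  moreover have "(\<lambda>x. (f x + g x)\<^sup>2) = (\<lambda>x. (f x)\<^sup>2 + (g x)\<^sup>2 + 2 * (f x * g x))"
    by (simp add: power2_sum fun_eq_iff)
  ultimately show ?thesis
    by (simp add: L2_def)
qed

lemma L2_diff:
  assumes "f \<in> L2 \<mu>" "g \<in> L2 \<mu>"
  shows "(\<lambda>x. f x - g x) \<in> L2 \<mu>"
  using L2_add[OF assms(1) L2_scale[OF assms(2), of "-1"]] by simp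

lemma L2_zero: "(\<lambda>x. 0) \<in> L2 \<mu>"
  by (simp add: L2_def)

lemma L2_sum:
  assumes "finite A" "\<And>i. i \<in> A \<Longrightarrow> f i \<in> L2 \<mu>"
  shows "(\<lambda>x. \<Sum>i\<in>A. f i x) \<in> L2 \<mu>"
  using assms by (induction A rule: finite_induct) (auto intro: L2_add L2_zero)

lemma L2_inner_commute: "L2_inner \<mu> f g = L2_inner \<mu> g f"
  by (simp add: L2_inner_def mult.commute)

lemma L2_inner_scale_left: "L2_inner \<mu> (\<lambda>x. c * f x) g = c * L2_inner \<mu> f g"
  by (simp add: L2_inner_def mult.assoc)

lemma L2_inner_scale_right: "L2_inner \<mu> f (\<lambda>x. c * g x) = c * L2_inner \<mu> f g"
  by (simp add: L2_inner_def mult.left_commute)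

lemma L2_inner_add_left:
  assumes "f \<in> L2 \<mu>" "g \<in> L2 \<mu>" "h \<in> L2 \<mu>"
  shows "L2_inner \<mu> (\<lambda>x. f x + g x) h = L2_inner \<mu> f h + L2_inner \<mu> g h"
  using assms L2_mult_integrable by (simp add: L2_inner_def distrib_right)

lemma L2_inner_add_right:
  assumes "f \<in> L2 \<mu>" "g \<in> L2 \<mu>" "h \<in> L2 \<mu>"
  shows "L2_inner \<mu> h (\<lambda>x. f x + g x) = L2_inner \<mu> h f + L2_inner \<mu> h g"
  using L2_inner_add_left[OF assms] by (simp add: L2_inner_commute)

lemma L2_inner_diff_left:
  assumes "f \<in> L2 \<mu>" "g \<in> L2 \<mu>" "h \<in> L2 \<mu>"
  shows "L2_inner \<mu> (\<lambda>x. f x - g x) h = L2_inner \<mu> f h - L2_inner \<mu> g h"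
  using assms L2_mult_integrable by (simp add: L2_inner_def left_diff_distrib)

lemma L2_inner_diff_right:
  assumes "f \<in> L2 \<mu>" "g \<in> L2 \<mu>" "h \<in> L2 \<mu>"
  shows "L2_inner \<mu> h (\<lambda>x. f x - g x) = L2_inner \<mu> h f - L2_inner \<mu> h g"
  using L2_inner_diff_left[OF assms] by (simp add: L2_inner_commute)

lemma L2_inner_sum_left:
  assumes "finite A" "\<And>i. i \<in> A \<Longrightarrow> f i \<in> L2 \<mu>" "h \<in> L2 \<mu>"
  shows "L2_inner \<mu> (\<lambda>x. \<Sum>i\<in>A. f i x) h = (\<Sum>i\<in>A. L2_inner \<mu> (f i) h)"
  using assms L2_mult_integrable by (simp add: L2_inner_def sum_distrib_right)

lemma L2_inner_cong_AE:
  assumes "f \<in> L2 \<mu>" "f' \<in> L2 \<mu>" "g \<in> L2 \<mu>" "AE x in \<mu>. f x = f' x"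
  shows "L2_inner \<mu> f g = L2_inner \<mu> f' g"
  unfolding L2_inner_def
  by (rule integral_cong_AE) (use assms in \<open>auto simp: L2_def\<close>)

lemma L2_inner_self_nonneg: "0 \<le> L2_inner \<mu> f f"
  by (simp add: L2_inner_def)

lemma L2_norm_nonneg: "0 \<le> L2_norm \<mu> f"
  by (simp add: L2_norm_def L2_inner_self_nonneg)

lemma L2_norm_power2: "(L2_norm \<mu> f)\<^sup>2 = L2_inner \<mu> f f"
  by (simp add: L2_norm_def L2_inner_self_nonneg)

lemma L2_norm_tendsto_0I:
  assumes "\<And>k. (L2_norm \<mu> (d k))\<^sup>2 \<le> b k" "b \<longlonglongrightarrow> 0"
  shows "(\<lambda>k. L2_norm \<mu> (d k)) \<longlonglongrightarrow> 0"
proof (rule tendsto_sandwich[where f="\<lambda>_. 0"])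
  show "(\<lambda>k. sqrt (b k)) \<longlonglongrightarrow> 0"
    using tendsto_real_sqrt[OF assms(2)] by simp
  show "\<forall>\<^sub>F k in sequentially. L2_norm \<mu> (d k) \<le> sqrt (b k)"
    by (intro always_eventually allI real_le_rsqrt assms(1))
qed (auto simp: L2_norm_nonneg)

lemma L2_norm_scale: "L2_norm \<mu> (\<lambda>x. c * f x) = \<bar>c\<bar> * L2_norm \<mu> f"
  by (simp add: L2_norm_def L2_inner_scale_left L2_inner_scale_right real_sqrt_mult mult.assoc[symmetric])

lemma L2_norm_cong_AE:
  assumes "f \<in> L2 \<mu>" "f' \<in> L2 \<mu>" "AE x in \<mu>. f x = f' x"
  shows "L2_norm \<mu> f = L2_norm \<mu> f'"
  using L2_inner_cong_AE[OF assms(1,2,1,3)] L2_inner_cong_AE[OF assms(1,2,2,3)]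
  by (simp add: L2_norm_def L2_inner_commute)

lemma L2_norm_zero_imp_AE:
  assumes "f \<in> L2 \<mu>" "L2_norm \<mu> f = 0"
  shows "AE x in \<mu>. f x = 0"
proof -
  have "(\<integral>x. (f x)\<^sup>2 \<partial>\<mu>) = 0"
    using assms(2) L2_norm_power2[of f] by (simp add: L2_inner_def power2_eq_square)
  then have "AE x in \<mu>. (f x)\<^sup>2 = 0"
    using integral_nonneg_eq_0_iff_AE[of \<mu> "\<lambda>x. (f x)\<^sup>2"] L2_D[OF assms(1)] by simp
  then show ?thesis by simp
qed

lemma L2_inner_self_add_scaled:
  assumes f: "f \<in> L2 \<mu>" and g: "g \<in> L2 \<mu>"
  shows "L2_inner \<mu> (\<lambda>x. f x + s * g x) (\<lambda>x. f x + s * g x)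
    = L2_inner \<mu> f f + 2 * s * L2_inner \<mu> f g + s\<^sup>2 * L2_inner \<mu> g g"
  using assms
  by (simp add: L2_inner_add_left L2_inner_add_right L2_inner_scale_left L2_inner_scale_right
      L2_scale L2_add L2_inner_commute[of g f])
    (simp add: algebra_simps power2_eq_square)

lemma L2_Cauchy_Schwarz:
  assumes f: "f \<in> L2 \<mu>" and g: "g \<in> L2 \<mu>"
  shows "\<bar>L2_inner \<mu> f g\<bar> \<le> L2_norm \<mu> f * L2_norm \<mu> g"
proof (cases "L2_norm \<mu> g = 0")
  case True
  from L2_norm_zero_imp_AE[OF g True]
  have "L2_inner \<mu> g f = L2_inner \<mu> (\<lambda>x. 0) f"
    by (intro L2_inner_cong_AE[OF g L2_zero f]) auto
  then have "L2_inner \<mu> f g = 0"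
    by (simp add: L2_inner_commute[of f g]) (simp add: L2_inner_def)
  then show ?thesis by (simp add: L2_norm_nonneg)
next
  case False
  define c where "c = L2_inner \<mu> g g"
  have c: "c > 0"
    using False L2_inner_self_nonneg[of g] by (auto simp: c_def L2_norm_def order_less_le)
  define s where "s = - L2_inner \<mu> f g / c"
  have "0 \<le> L2_inner \<mu> f f + 2 * s * L2_inner \<mu> f g + s\<^sup>2 * c"
    unfolding c_def L2_inner_self_add_scaled[OF f g, symmetric] by (rule L2_inner_self_nonneg)
  also have "\<dots> = L2_inner \<mu> f f - (L2_inner \<mu> f g)\<^sup>2 / c"
    using c by (simp add: s_def field_simps power2_eq_square)
  finally have "(L2_inner \<mu> f g)\<^sup>2 \<le> L2_inner \<mu> f f * c"
    using c by (simp add: field_simps)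
  also have "\<dots> = (L2_norm \<mu> f * L2_norm \<mu> g)\<^sup>2"
    by (simp add: c_def power_mult_distrib L2_norm_power2)
  finally show ?thesis
    using abs_le_square_iff[of "L2_inner \<mu> f g" "L2_norm \<mu> f * L2_norm \<mu> g"]
    by (simp add: L2_norm_nonneg)
qed

lemma L2_triangle:
  assumes f: "f \<in> L2 \<mu>" and g: "g \<in> L2 \<mu>"
  shows "L2_norm \<mu> (\<lambda>x. f x + g x) \<le> L2_norm \<mu> f + L2_norm \<mu> g"
proof (rule power2_le_imp_le)
  have "(L2_norm \<mu> (\<lambda>x. f x + g x))\<^sup>2
    = (L2_norm \<mu> f)\<^sup>2 + 2 * L2_inner \<mu> f g + (L2_norm \<mu> g)\<^sup>2"
    using L2_inner_self_add_scaled[OF f g, of 1] by (simp add: L2_norm_power2)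
  then show "(L2_norm \<mu> (\<lambda>x. f x + g x))\<^sup>2 \<le> (L2_norm \<mu> f + L2_norm \<mu> g)\<^sup>2"
    using L2_Cauchy_Schwarz[OF f g] by (simp add: power2_sum)
qed (simp add: L2_norm_nonneg)

lemma L2_triangle_diff:
  assumes f: "f \<in> L2 \<mu>" and g: "g \<in> L2 \<mu>" and h: "h \<in> L2 \<mu>"
  shows "L2_norm \<mu> (\<lambda>x. f x - h x) \<le> L2_norm \<mu> (\<lambda>x. f x - g x) + L2_norm \<mu> (\<lambda>x. g x - h x)"
  using L2_triangle[OF L2_diff[OF f g] L2_diff[OF g h]] by simp

lemma L2_norm_minus_commute: "L2_norm \<mu> (\<lambda>x. f x - g x) = L2_norm \<mu> (\<lambda>x. g x - f x)"
  using L2_norm_scale[of "-1" "\<lambda>x. f x - g x"] by simp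

lemma L2_norm_le_bound:
  assumes "f \<in> borel_measurable \<mu>" "0 \<le> c" "\<And>x. \<bar>f x\<bar> \<le> c"
  shows "L2_norm \<mu> f \<le> c * sqrt (measure \<mu> (space \<mu>))"
proof -
  have f: "f \<in> L2 \<mu>" using assms by (auto intro: L2_bounded)
  have "L2_inner \<mu> f f \<le> (\<integral>x. c\<^sup>2 \<partial>\<mu>)"
    unfolding L2_inner_def
    using assms L2_mult_integrable[OF f f]
    by (intro integral_mono) (auto simp: power2_eq_square[symmetric] abs_le_square_iff[symmetric])
  also have "\<dots> = (c * sqrt (measure \<mu> (space \<mu>)))\<^sup>2"
    by (simp add: power_mult_distrib)
  finally show ?thesis
    unfolding L2_norm_def using assms(2) by (intro real_le_lsqrt) auto
qed

lemma L2_dominated_convergence: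
  assumes u: "\<And>n. u n \<in> borel_measurable \<mu>" and v: "v \<in> borel_measurable \<mu>"
    and b: "\<And>n x. \<bar>u n x\<bar> \<le> c"
    and lim: "AE x in \<mu>. (\<lambda>n. u n x) \<longlonglongrightarrow> v x"
  shows "v \<in> L2 \<mu>" "(\<lambda>n. L2_norm \<mu> (\<lambda>x. u n x - v x)) \<longlonglongrightarrow> 0"
proof -
  have vb: "AE x in \<mu>. \<bar>v x\<bar> \<le> c"
    using lim
  proof eventually_elim
    case (elim x)
    have "(\<lambda>n. \<bar>u n x\<bar>) \<longlonglongrightarrow> \<bar>v x\<bar>"
      using elim by (intro tendsto_intros)
    then show ?case by (rule LIMSEQ_le_const2) (use b in auto)
  qed
  show "v \<in> L2 \<mu>" by (rule L2_bounded[OF v vb])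
  have "(\<lambda>n. \<integral>x. (u n x - v x) * (u n x - v x) \<partial>\<mu>) \<longlonglongrightarrow> (\<integral>x. 0 \<partial>\<mu>)"
  proof (rule integral_dominated_convergence[where w="\<lambda>x. (2 * c)\<^sup>2"])
    show "AE x in \<mu>. (\<lambda>n. (u n x - v x) * (u n x - v x)) \<longlonglongrightarrow> 0"
      using lim
    proof eventually_elim
      case (elim x)
      then have "(\<lambda>n. (u n x - v x) * (u n x - v x)) \<longlonglongrightarrow> (v x - v x) * (v x - v x)"
        by (intro tendsto_intros)
      then show ?case by simp
    qed
    show "AE x in \<mu>. norm ((u n x - v x) * (u n x - v x)) \<le> (2 * c)\<^sup>2" for n
      using vb
    proof eventually_elim
      case (elim x)
      have "\<bar>u n x - v x\<bar> \<le> \<bar>2 * c\<bar>" using b[of n x] elim by linarith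
      then show ?case
        by (simp add: power2_eq_square[symmetric] abs_le_square_iff del: power_mult_distrib)
    qed
  qed (use u v in auto)
  then have "(\<lambda>n. sqrt (L2_inner \<mu> (\<lambda>x. u n x - v x) (\<lambda>x. u n x - v x))) \<longlonglongrightarrow> sqrt 0"
    unfolding L2_inner_def by (intro tendsto_intros) simp
  then show "(\<lambda>n. L2_norm \<mu> (\<lambda>x. u n x - v x)) \<longlonglongrightarrow> 0"
    by (simp add: L2_norm_def)
qed

lemma L2_inner_tendsto:
  assumes "\<And>n. u n \<in> L2 \<mu>" "v \<in> L2 \<mu>" "g \<in> L2 \<mu>" "(\<lambda>n. L2_norm \<mu> (\<lambda>x. u n x - v x)) \<longlonglongrightarrow> 0"
  shows "(\<lambda>n. L2_inner \<mu> (u n) g) \<longlonglongrightarrow> L2_inner \<mu> v g"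
proof -
  have le: "\<bar>L2_inner \<mu> (u n) g - L2_inner \<mu> v g\<bar> \<le> L2_norm \<mu> (\<lambda>x. u n x - v x) * L2_norm \<mu> g" for n
    using L2_Cauchy_Schwarz[OF L2_diff[OF assms(1,2)] assms(3), of n] assms
    by (simp add: L2_inner_diff_left)
  show ?thesis
  proof (rule LIM_zero_cancel, rule Lim_null_comparison)
    show "\<forall>\<^sub>F n in sequentially. norm (L2_inner \<mu> (u n) g - L2_inner \<mu> v g)
      \<le> L2_norm \<mu> (\<lambda>x. u n x - v x) * L2_norm \<mu> g"
      unfolding real_norm_def by (intro always_eventually allI le)
    show "(\<lambda>n. L2_norm \<mu> (\<lambda>x. u n x - v x) * L2_norm \<mu> g) \<longlonglongrightarrow> 0"
      by (rule tendsto_mult_left_zero[OF assms(4)])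
  qed
qed

lemma L2_closure_limit:
  assumes A: "A \<subseteq> L2 \<mu>" and h: "h \<in> L2 \<mu>" and u: "\<And>n. u n \<in> L2_closure \<mu> A"
    and lim: "(\<lambda>n. L2_norm \<mu> (\<lambda>x. u n x - h x)) \<longlonglongrightarrow> 0"
  shows "h \<in> L2_closure \<mu> A"
  unfolding L2_closure_def
proof (intro CollectI conjI allI impI h)
  fix \<epsilon> :: real assume eps: "0 < \<epsilon>"
  obtain n where n: "L2_norm \<mu> (\<lambda>x. u n x - h x) < \<epsilon> / 2"
    using LIMSEQ_D[OF lim half_gt_zero[OF eps]] by (auto simp: L2_norm_nonneg)
  have un: "u n \<in> L2 \<mu>" using u by (simp add: L2_closure_def)
  obtain g where g: "g \<in> A" "L2_norm \<mu> (\<lambda>x. u n x - g x) < \<epsilon> / 2"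
    using u[of n] half_gt_zero[OF eps] unfolding L2_closure_def by blast
  have "L2_norm \<mu> (\<lambda>x. h x - g x) < \<epsilon>"
    using L2_triangle_diff[OF h un, of g] g n A by (auto simp: L2_norm_minus_commute[of h "u n"])
  then show "\<exists>g\<in>A. L2_norm \<mu> (\<lambda>x. h x - g x) < \<epsilon>" using g by blast
qed

text \<open>What remains of \<open>f\<close> after subtracting its first \<open>n\<close> Fourier terms along \<open>\<phi>\<close>.\<close>

definition fourier_remainder :: "(nat \<Rightarrow> real \<Rightarrow> real) \<Rightarrow> nat \<Rightarrow> (real \<Rightarrow> real) \<Rightarrow> real \<Rightarrow> real" where
  "fourier_remainder \<phi> n f = (\<lambda>x. f x - (\<Sum>i<n. L2_inner \<mu> f (\<phi> i) * \<phi> i x))"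

context
  fixes \<phi> :: "nat \<Rightarrow> real \<Rightarrow> real"
  assumes phi: "\<And>j. \<phi> j \<in> L2 \<mu>"
    and orth: "\<And>i j. L2_inner \<mu> (\<phi> i) (\<phi> j) = (if i = j then 1 else 0)"
begin

lemma fourier_sum_L2: "(\<lambda>x. \<Sum>i<n. c i * \<phi> i x) \<in> L2 \<mu>"
  by (intro L2_sum L2_scale phi) auto

lemma fourier_remainder_L2: "f \<in> L2 \<mu> \<Longrightarrow> fourier_remainder \<phi> n f \<in> L2 \<mu>"
  unfolding fourier_remainder_def by (intro L2_diff fourier_sum_L2)

lemma inner_fourier_remainder:
  assumes "f \<in> L2 \<mu>" "g \<in> L2 \<mu>"
  shows "L2_inner \<mu> (fourier_remainder \<phi> n f) g
    = L2_inner \<mu> f g - (\<Sum>i<n. L2_inner \<mu> f (\<phi> i) * L2_inner \<mu> (\<phi> i) g)"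
  unfolding fourier_remainder_def
  using assms by (subst L2_inner_diff_left)
    (auto simp: fourier_sum_L2 L2_inner_sum_left L2_scale phi L2_inner_scale_left)

lemma fourier_remainder_orthogonal:
  assumes "f \<in> L2 \<mu>" "j < n"
  shows "L2_inner \<mu> (fourier_remainder \<phi> n f) (\<phi> j) = 0"
proof -
  have "(\<Sum>i<n. L2_inner \<mu> f (\<phi> i) * L2_inner \<mu> (\<phi> i) (\<phi> j))
    = (\<Sum>i<n. if i = j then L2_inner \<mu> f (\<phi> i) else 0)"
    by (intro sum.cong) (auto simp: orth)
  then show ?thesis
    using assms by (simp add: inner_fourier_remainder phi)
qed

lemma inner_fourier_remainder_self:
  assumes "f \<in> L2 \<mu>"
  shows "L2_inner \<mu> (fourier_remainder \<phi> n f) (fourier_remainder \<phi> n f)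
    = L2_inner \<mu> f (fourier_remainder \<phi> n f)"
proof -
  have "L2_inner \<mu> (\<phi> i) (fourier_remainder \<phi> n f) = 0" if "i < n" for i
    using fourier_remainder_orthogonal[OF assms that] by (subst L2_inner_commute)
  then show ?thesis
    using inner_fourier_remainder[OF assms fourier_remainder_L2[OF assms]] by simp
qed

lemma norm_fourier_remainder_le:
  assumes "f \<in> L2 \<mu>"
  shows "L2_norm \<mu> (fourier_remainder \<phi> n f) \<le> L2_norm \<mu> f"
proof (rule power2_le_imp_le)
  show "(L2_norm \<mu> (fourier_remainder \<phi> n f))\<^sup>2 \<le> (L2_norm \<mu> f)\<^sup>2"
    unfolding L2_norm_power2 inner_fourier_remainder_self[OF assms]
    unfolding L2_inner_commute[of f "fourier_remainder \<phi> n f"] inner_fourier_remainder[OF assms assms]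
    by (simp add: L2_inner_commute[of f "\<phi> _"] sum_nonneg)
qed (rule L2_norm_nonneg)

lemma fourier_remainder_diff:
  assumes "f \<in> L2 \<mu>" "g \<in> L2 \<mu>"
  shows "fourier_remainder \<phi> n (\<lambda>x. f x - g x)
    = (\<lambda>x. fourier_remainder \<phi> n f x - fourier_remainder \<phi> n g x)"
  using assms by (simp add: fourier_remainder_def L2_inner_diff_left phi left_diff_distrib sum_subtractf fun_eq_iff)

end

end

section \<open>Compact positive operators and their eigenvalues\<close>

text \<open>A positive self-adjoint operator that maps \<open>L\<^sup>2(\<mu>)\<close> boundedly into the bounded functions, and
  for which the image of every sequence in the unit ball has a subsequence that converges almost
  everywhere. The operator acts on functions, not on classes. By dominated convergence, convergence
  almost everywhere of such images implies convergence in \<open>L\<^sup>2(\<mu>)\<close>, and the limit is obtained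
  without an appeal to completeness of that space.\<close>

locale compact_positive_op = finite_L2 +
  fixes T :: "(real \<Rightarrow> real) \<Rightarrow> real \<Rightarrow> real" and B :: real
  assumes T_measurable: "\<And>f. f \<in> L2 \<mu> \<Longrightarrow> T f \<in> borel_measurable \<mu>"
    and T_bound: "\<And>f x. f \<in> L2 \<mu> \<Longrightarrow> \<bar>T f x\<bar> \<le> B * L2_norm \<mu> f"
    and B_nonneg: "0 \<le> B"
    and T_add: "\<And>f g. f \<in> L2 \<mu> \<Longrightarrow> g \<in> L2 \<mu> \<Longrightarrow> T (\<lambda>x. f x + g x) = (\<lambda>x. T f x + T g x)"
    and T_scale: "\<And>f c. f \<in> L2 \<mu> \<Longrightarrow> T (\<lambda>x. c * f x) = (\<lambda>x. c * T f x)"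
    and T_sym: "\<And>f g. f \<in> L2 \<mu> \<Longrightarrow> g \<in> L2 \<mu> \<Longrightarrow> L2_inner \<mu> (T f) g = L2_inner \<mu> f (T g)"
    and T_pos: "\<And>f. f \<in> L2 \<mu> \<Longrightarrow> 0 \<le> L2_inner \<mu> (T f) f"
    and T_compact: "\<And>u. (\<And>n. u n \<in> L2 \<mu>) \<Longrightarrow> (\<And>n. L2_norm \<mu> (u n) \<le> 1) \<Longrightarrow>
      \<exists>(r :: nat \<Rightarrow> nat) v. strict_mono r \<and> v \<in> borel_measurable \<mu> \<and>
        (AE x in \<mu>. (\<lambda>n. T (u (r n)) x) \<longlonglongrightarrow> v x)"
begin

text \<open>A bound for the operator norm; the summand \<open>1\<close> makes it positive.\<close>

definition op_bound :: real where
  "op_bound = B * sqrt (measure \<mu> (space \<mu>)) + 1"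

lemma op_bound_pos: "0 < op_bound"
  using B_nonneg by (simp add: op_bound_def add_nonneg_pos)

lemma T_L2: "f \<in> L2 \<mu> \<Longrightarrow> T f \<in> L2 \<mu>"
  using L2_bounded[OF T_measurable AE_I2[OF T_bound]] by blast

lemma T_diff:
  assumes "f \<in> L2 \<mu>" "g \<in> L2 \<mu>"
  shows "T (\<lambda>x. f x - g x) = (\<lambda>x. T f x - T g x)"
  using T_add[OF assms(1) L2_scale[OF assms(2), of "-1"]] T_scale[OF assms(2), of "-1"] by simp

lemma T_sum:
  assumes "finite A" "\<And>i. i \<in> A \<Longrightarrow> f i \<in> L2 \<mu>"
  shows "T (\<lambda>x. \<Sum>i\<in>A. f i x) = (\<lambda>x. \<Sum>i\<in>A. T (f i) x)"
  using assms
proof (induction A rule: finite_induct)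
  case empty
  then show ?case using T_scale[OF L2_zero, of 0] by simp
next
  case (insert a A)
  then show ?case by (simp add: T_add L2_sum)
qed

lemma norm_T_le:
  assumes f: "f \<in> L2 \<mu>"
  shows "L2_norm \<mu> (T f) \<le> op_bound * L2_norm \<mu> f"
proof -
  have "L2_norm \<mu> (T f) \<le> (B * L2_norm \<mu> f) * sqrt (measure \<mu> (space \<mu>))"
    using f by (intro L2_norm_le_bound T_measurable T_bound mult_nonneg_nonneg B_nonneg L2_norm_nonneg)
  also have "\<dots> \<le> op_bound * L2_norm \<mu> f"
    using L2_norm_nonneg[of f] by (simp add: op_bound_def algebra_simps)
  finally show ?thesis .
qed

text \<open>The Cauchy--Schwarz inequality for the positive form \<open>\<langle>Tf, g\<rangle>\<close> in the case \<open>g = Tf\<close>, with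
  \<open>\<langle>Tg, g\<rangle>\<close> bounded by \<open>c\<langle>g, g\<rangle>\<close>: it is the nonnegativity of the form at \<open>f - Tf / c\<close>.\<close>

lemma norm_T_power2_le:
  assumes f: "f \<in> L2 \<mu>" and c: "0 < c"
    and Tf: "L2_inner \<mu> (T (T f)) (T f) \<le> c * L2_inner \<mu> (T f) (T f)"
  shows "(L2_norm \<mu> (T f))\<^sup>2 \<le> c * L2_inner \<mu> (T f) f"
proof -
  define w where "w = T f"
  have w: "w \<in> L2 \<mu>" unfolding w_def by (rule T_L2[OF f])
  have Tw: "T w \<in> L2 \<mu>" by (rule T_L2[OF w])
  define s where "s = 1 / c"
  have "0 \<le> L2_inner \<mu> (T (\<lambda>x. f x - s * w x)) (\<lambda>x. f x - s * w x)"
    by (intro T_pos L2_diff L2_scale f w)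
  also have "T (\<lambda>x. f x - s * w x) = (\<lambda>x. w x - s * T w x)"
    using T_diff[OF f L2_scale[OF w]] T_scale[OF w] by (simp add: w_def)
  also have "L2_inner \<mu> (\<lambda>x. w x - s * T w x) (\<lambda>x. f x - s * w x)
     = L2_inner \<mu> w f - s * L2_inner \<mu> w w - s * (L2_inner \<mu> (T w) f - s * L2_inner \<mu> (T w) w)"
    using f w Tw by (simp add: L2_inner_diff_left L2_inner_diff_right L2_scale L2_diff
      L2_inner_scale_left L2_inner_scale_right right_diff_distrib)
  also have "L2_inner \<mu> (T w) f = L2_inner \<mu> w w"
    using T_sym[OF w f] by (simp add: w_def)
  finally have "2 * s * L2_inner \<mu> w w \<le> L2_inner \<mu> w f + s * (s * L2_inner \<mu> (T w) w)"
    by (simp add: algebra_simps)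
  also have "\<dots> \<le> L2_inner \<mu> w f + s * (s * (c * L2_inner \<mu> w w))"
    using Tf c by (intro add_left_mono mult_left_mono) (auto simp: w_def s_def)
  finally show ?thesis
    using c by (simp add: s_def w_def[symmetric] L2_norm_power2 field_simps)
qed

lemma inner_T_le:
  assumes f: "f \<in> L2 \<mu>"
  shows "L2_inner \<mu> (T f) f \<le> op_bound * L2_inner \<mu> f f"
proof -
  have "L2_inner \<mu> (T f) f \<le> L2_norm \<mu> (T f) * L2_norm \<mu> f"
    using L2_Cauchy_Schwarz[OF T_L2[OF f] f] by simp
  also have "\<dots> \<le> (op_bound * L2_norm \<mu> f) * L2_norm \<mu> f"
    by (intro mult_right_mono norm_T_le f L2_norm_nonneg)
  finally show ?thesis
    unfolding L2_norm_power2[symmetric] by (simp only: power2_eq_square mult.assoc)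
qed

lemma T_compact_L2:
  assumes u: "\<And>n. u n \<in> L2 \<mu>" "\<And>n. L2_norm \<mu> (u n) \<le> 1"
  obtains r :: "nat \<Rightarrow> nat" and v where "strict_mono r" "v \<in> L2 \<mu>"
    "(\<lambda>n. L2_norm \<mu> (\<lambda>x. T (u (r n)) x - v x)) \<longlonglongrightarrow> 0"
proof -
  obtain r :: "nat \<Rightarrow> nat" and v where rv: "strict_mono r" "v \<in> borel_measurable \<mu>"
    "AE x in \<mu>. (\<lambda>n. T (u (r n)) x) \<longlonglongrightarrow> v x"
    using T_compact[of u, OF u] by (elim exE conjE)
  have "\<bar>T (u (r n)) x\<bar> \<le> B" for n x
    using T_bound[OF u(1), of "r n" x] mult_left_mono[OF u(2) B_nonneg, of "r n"] by simp
  note lim = L2_dominated_convergence[of "\<lambda>n. T (u (r n))" v B, OF T_measurable[OF u(1)] rv(2) this rv(3)]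
  show ?thesis by (rule that[OF rv(1) lim])
qed

text \<open>On the orthogonal complement of eigenfunctions, the supremum of the quadratic form over the
  unit ball is attained at an eigenfunction: vectors that nearly attain the supremum \<open>\<rho>\<close> nearly
  satisfy \<open>Tu = \<rho>u\<close>, and compactness gives a limit.\<close>

lemma rayleigh_maximum:
  fixes \<phi> :: "nat \<Rightarrow> real \<Rightarrow> real"
  assumes phi: "\<And>i. i < n \<Longrightarrow> \<phi> i \<in> L2 \<mu>"
    and eig: "\<And>i. i < n \<Longrightarrow> AE x in \<mu>. T (\<phi> i) x = e i * \<phi> i x"
  obtains \<rho> where "0 \<le> \<rho>"
    "\<forall>f\<in>L2 \<mu>. (\<forall>i<n. L2_inner \<mu> f (\<phi> i) = 0) \<longrightarrow> L2_inner \<mu> (T f) f \<le> \<rho> * L2_inner \<mu> f f"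
    "0 < \<rho> \<longrightarrow> (\<exists>v\<in>L2 \<mu>. (\<forall>i<n. L2_inner \<mu> v (\<phi> i) = 0) \<and> L2_norm \<mu> v > 0 \<and>
      (AE x in \<mu>. T v x = \<rho> * v x))"
proof -
  define V where "V = {f \<in> L2 \<mu>. \<forall>i<n. L2_inner \<mu> f (\<phi> i) = 0}"
  define S where "S = (\<lambda>f. L2_inner \<mu> (T f) f) ` {f \<in> V. L2_norm \<mu> f \<le> 1}"
  define \<rho> where "\<rho> = Sup S"
  have VL: "f \<in> V \<Longrightarrow> f \<in> L2 \<mu>" for f by (simp add: V_def)
  have V0: "(\<lambda>x. 0) \<in> V" by (simp add: V_def L2_zero) (simp add: L2_inner_def)
  have Vscale: "(\<lambda>x. c * f x) \<in> V" if "f \<in> V" for c f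
    using that by (auto simp: V_def L2_scale L2_inner_scale_left)
  have VT: "T f \<in> V" if "f \<in> V" for f
  proof -
    have "L2_inner \<mu> (T f) (\<phi> i) = 0" if "i < n" for i
    proof -
      have "L2_inner \<mu> (T f) (\<phi> i) = L2_inner \<mu> (T (\<phi> i)) f"
        using T_sym[OF VL[OF \<open>f \<in> V\<close>] phi[OF that]] by (simp add: L2_inner_commute)
      also have "\<dots> = L2_inner \<mu> (\<lambda>x. e i * \<phi> i x) f"
        using VL[OF \<open>f \<in> V\<close>] by (intro L2_inner_cong_AE eig T_L2 phi L2_scale that)
      also have "\<dots> = 0"
        using \<open>f \<in> V\<close> that by (simp add: V_def L2_inner_scale_left L2_inner_commute[of "\<phi> i" f])
      finally show ?thesis .
    qed
    then show ?thesis using VL[OF that] by (simp add: V_def T_L2)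
  qed
  have S0: "0 \<in> S"
    unfolding S_def using V0
    by (intro image_eqI[of _ _ "\<lambda>x. 0"]) (auto simp: L2_norm_def L2_inner_def)
  have bdd: "bdd_above S"
  proof (rule bdd_aboveI)
    fix y assume "y \<in> S"
    then obtain f where f: "f \<in> V" "L2_norm \<mu> f \<le> 1" "y = L2_inner \<mu> (T f) f"
      by (auto simp: S_def)
    have "y \<le> op_bound * (L2_norm \<mu> f)\<^sup>2"
      using inner_T_le[OF VL[OF f(1)]] f(3) by (simp add: L2_norm_power2)
    also have "\<dots> \<le> op_bound * 1"
      using f(2) L2_norm_nonneg[of f] op_bound_pos
      by (intro mult_left_mono) (auto simp: power_le_one)
    finally show "y \<le> op_bound" by simp
  qed
  have rho0: "0 \<le> \<rho>" unfolding \<rho>_def by (rule cSup_upper[OF S0 bdd])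
  have ray: "L2_inner \<mu> (T f) f \<le> \<rho> * L2_inner \<mu> f f" if f: "f \<in> V" for f
  proof (cases "L2_norm \<mu> f = 0")
    case True
    then have "L2_inner \<mu> f f = 0" by (simp add: L2_norm_def)
    then show ?thesis using inner_T_le[OF VL[OF f]] by simp
  next
    case False
    define k where "k = L2_norm \<mu> f"
    have k: "k > 0" using False L2_norm_nonneg[of f] by (simp add: k_def)
    have "L2_inner \<mu> (T (\<lambda>x. 1 / k * f x)) (\<lambda>x. 1 / k * f x) \<in> S"
      unfolding S_def using Vscale[OF f, of "1 / k"] k L2_norm_scale[of "1 / k" f]
      by (intro imageI) (auto simp: k_def[symmetric])
    then have "L2_inner \<mu> (T (\<lambda>x. 1 / k * f x)) (\<lambda>x. 1 / k * f x) \<le> \<rho>"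
      unfolding \<rho>_def by (rule cSup_upper[OF _ bdd])
    then have "(1 / k) * ((1 / k) * L2_inner \<mu> (T f) f) \<le> \<rho>"
      unfolding T_scale[OF VL[OF f]] L2_inner_scale_left L2_inner_scale_right .
    then have "L2_inner \<mu> (T f) f \<le> \<rho> * k\<^sup>2"
      using k by (simp add: field_simps power2_eq_square)
    then show ?thesis by (simp add: k_def L2_norm_power2)
  qed
  have "\<exists>v\<in>L2 \<mu>. (\<forall>i<n. L2_inner \<mu> v (\<phi> i) = 0) \<and> L2_norm \<mu> v > 0 \<and>
      (AE x in \<mu>. T v x = \<rho> * v x)" if rho: "\<rho> > 0"
  proof -
    have "\<exists>f. f \<in> V \<and> L2_norm \<mu> f \<le> 1 \<and> \<rho> - inverse (real (Suc k)) < L2_inner \<mu> (T f) f" for k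
    proof -
      have "\<rho> - inverse (real (Suc k)) < Sup S" by (simp add: \<rho>_def)
      then obtain y where "y \<in> S" "\<rho> - inverse (real (Suc k)) < y"
        using less_cSup_iff[OF _ bdd] S0 by blast
      then show ?thesis by (auto simp: S_def)
    qed
    then obtain u where u: "\<And>k. u k \<in> V" "\<And>k. L2_norm \<mu> (u k) \<le> 1"
      "\<And>k. \<rho> - inverse (real (Suc k)) < L2_inner \<mu> (T (u k)) (u k)"
      by metis
    have uL: "u k \<in> L2 \<mu>" and TuL: "T (u k) \<in> L2 \<mu>" for k using VL[OF u(1)] T_L2 by auto
    define d where "d = (\<lambda>k x. T (u k) x - \<rho> * u k x)"
    have dL: "d k \<in> L2 \<mu>" for k
      unfolding d_def by (intro L2_diff L2_scale uL TuL)
    have d2: "(L2_norm \<mu> (d k))\<^sup>2 \<le> \<rho> * inverse (real (Suc k))" for k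
    proof -
      have "(L2_norm \<mu> (d k))\<^sup>2
        = L2_inner \<mu> (T (u k)) (T (u k)) + 2 * (- \<rho>) * L2_inner \<mu> (T (u k)) (u k)
          + \<rho>\<^sup>2 * L2_inner \<mu> (u k) (u k)"
        using L2_inner_self_add_scaled[OF TuL uL, of k "-\<rho>" k] by (simp add: L2_norm_power2 d_def)
      moreover have "L2_inner \<mu> (T (u k)) (T (u k)) \<le> \<rho> * L2_inner \<mu> (T (u k)) (u k)"
        using norm_T_power2_le[OF uL rho ray[OF VT[OF u(1)]]] by (simp add: L2_norm_power2)
      moreover have "\<rho>\<^sup>2 * L2_inner \<mu> (u k) (u k) \<le> \<rho>\<^sup>2 * 1"
        unfolding L2_norm_power2[symmetric]
        by (intro mult_left_mono power_le_one u(2) L2_norm_nonneg) simp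
      ultimately have "(L2_norm \<mu> (d k))\<^sup>2 \<le> \<rho>\<^sup>2 - \<rho> * L2_inner \<mu> (T (u k)) (u k)"
        by linarith
      also have "\<dots> = \<rho> * (\<rho> - L2_inner \<mu> (T (u k)) (u k))"
        by (simp add: right_diff_distrib power2_eq_square)
      also have "\<dots> \<le> \<rho> * inverse (real (Suc k))"
        using u(3)[of k] rho by (intro mult_left_mono) auto
      finally show ?thesis .
    qed
    have d0: "(\<lambda>k. L2_norm \<mu> (d k)) \<longlonglongrightarrow> 0"
      by (rule L2_norm_tendsto_0I[OF d2 tendsto_mult_right_zero[OF LIMSEQ_inverse_real_of_nat]])
    obtain r :: "nat \<Rightarrow> nat" and v where r: "strict_mono r" and v: "v \<in> L2 \<mu>"
      and lim: "(\<lambda>k. L2_norm \<mu> (\<lambda>x. T (u (r k)) x - v x)) \<longlonglongrightarrow> 0"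
      using T_compact_L2[OF uL u(2)] .
    have d0r: "(\<lambda>k. L2_norm \<mu> (d (r k))) \<longlonglongrightarrow> 0"
      using LIMSEQ_subseq_LIMSEQ[OF d0 r] by (simp add: o_def)
    have orth_v: "L2_inner \<mu> v (\<phi> i) = 0" if "i < n" for i
    proof -
      have "(\<lambda>k. L2_inner \<mu> (T (u (r k))) (\<phi> i)) \<longlonglongrightarrow> L2_inner \<mu> v (\<phi> i)"
        by (intro L2_inner_tendsto TuL v phi that lim)
      moreover have "L2_inner \<mu> (T (u (r k))) (\<phi> i) = 0" for k
        using VT[OF u(1)] that by (simp add: V_def)
      ultimately show ?thesis by (simp add: LIMSEQ_const_iff)
    qed
    have le_Tu: "\<rho> - inverse (real (Suc k)) \<le> L2_norm \<mu> (T (u k))" for k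
    proof -
      have "L2_inner \<mu> (T (u k)) (u k) \<le> L2_norm \<mu> (T (u k)) * L2_norm \<mu> (u k)"
        using L2_Cauchy_Schwarz[OF TuL uL, of k k] by simp
      also have "\<dots> \<le> L2_norm \<mu> (T (u k)) * 1"
        by (intro mult_left_mono u(2) L2_norm_nonneg)
      finally show ?thesis using u(3)[of k] by simp
    qed
    have "\<rho> \<le> L2_norm \<mu> v"
    proof (rule LIMSEQ_le)
      show "(\<lambda>k. \<rho> - inverse (real (Suc (r k)))) \<longlonglongrightarrow> \<rho>"
        using tendsto_diff[OF tendsto_const LIMSEQ_subseq_LIMSEQ[OF LIMSEQ_inverse_real_of_nat r], of \<rho>]
        by (simp add: o_def)
      show "(\<lambda>k. L2_norm \<mu> (\<lambda>x. T (u (r k)) x - v x) + L2_norm \<mu> v) \<longlonglongrightarrow> L2_norm \<mu> v"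
        using tendsto_add[OF lim tendsto_const] by simp
      show "\<exists>N. \<forall>k\<ge>N. \<rho> - inverse (real (Suc (r k)))
          \<le> L2_norm \<mu> (\<lambda>x. T (u (r k)) x - v x) + L2_norm \<mu> v"
      proof (intro exI allI impI)
        fix k
        have "L2_norm \<mu> (T (u (r k))) \<le> L2_norm \<mu> (\<lambda>x. T (u (r k)) x - v x) + L2_norm \<mu> v"
          using L2_triangle[OF L2_diff[OF TuL v] v, of "r k"] by simp
        then show "\<rho> - inverse (real (Suc (r k)))
          \<le> L2_norm \<mu> (\<lambda>x. T (u (r k)) x - v x) + L2_norm \<mu> v"
          using le_Tu[of "r k"] by linarith
      qed
    qed
    then have v_pos: "L2_norm \<mu> v > 0" using rho by simp
    have DL: "(\<lambda>x. T v x - \<rho> * v x) \<in> L2 \<mu>" by (intro L2_diff L2_scale T_L2 v)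
    have "L2_norm \<mu> (\<lambda>x. T v x - \<rho> * v x) \<le> 0"
    proof (rule LIMSEQ_le_const)
      let ?a = "\<lambda>k. L2_norm \<mu> (\<lambda>x. T (u (r k)) x - v x)"
      show "(\<lambda>k. op_bound * ?a k + (op_bound * L2_norm \<mu> (d (r k)) + \<rho> * ?a k)) \<longlonglongrightarrow> 0"
        using tendsto_add[OF tendsto_mult_right_zero[OF lim, of op_bound]
          tendsto_add[OF tendsto_mult_right_zero[OF d0r, of op_bound]
            tendsto_mult_right_zero[OF lim, of \<rho>]]] by simp
      show "\<exists>N. \<forall>k\<ge>N. L2_norm \<mu> (\<lambda>x. T v x - \<rho> * v x)
        \<le> op_bound * ?a k + (op_bound * L2_norm \<mu> (d (r k)) + \<rho> * ?a k)"
      proof (intro exI allI impI)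
        fix k
        define w where "w = T (u (r k))"
        have w: "w \<in> L2 \<mu>" unfolding w_def by (rule TuL)
        have Td: "T (d (r k)) = (\<lambda>x. T w x - \<rho> * w x)"
          unfolding d_def w_def using T_diff[OF TuL L2_scale[OF uL]] T_scale[OF uL] by simp
        have "L2_norm \<mu> (\<lambda>x. T v x - \<rho> * v x)
            \<le> L2_norm \<mu> (\<lambda>x. T v x - T w x) + L2_norm \<mu> (\<lambda>x. T w x - \<rho> * v x)"
          by (intro L2_triangle_diff T_L2 L2_scale v w)
        moreover have "L2_norm \<mu> (\<lambda>x. T w x - \<rho> * v x)
            \<le> L2_norm \<mu> (\<lambda>x. T w x - \<rho> * w x) + L2_norm \<mu> (\<lambda>x. \<rho> * w x - \<rho> * v x)"
          by (intro L2_triangle_diff T_L2 L2_scale v w)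
        moreover have "L2_norm \<mu> (\<lambda>x. T w x - \<rho> * w x) \<le> op_bound * L2_norm \<mu> (d (r k))"
          unfolding Td[symmetric] by (rule norm_T_le[OF dL])
        moreover have "L2_norm \<mu> (\<lambda>x. \<rho> * w x - \<rho> * v x) = \<rho> * ?a k"
          using L2_norm_scale[of \<rho> "\<lambda>x. w x - v x"] rho by (simp add: w_def right_diff_distrib)
        moreover have "L2_norm \<mu> (\<lambda>x. T v x - T w x) \<le> op_bound * ?a k"
          using norm_T_le[OF L2_diff[OF v w]]
          unfolding T_diff[OF v w] L2_norm_minus_commute[of v w] by (simp add: w_def)
        ultimately show "L2_norm \<mu> (\<lambda>x. T v x - \<rho> * v x)
          \<le> op_bound * ?a k + (op_bound * L2_norm \<mu> (d (r k)) + \<rho> * ?a k)"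
          by linarith
      qed
    qed
    then have "L2_norm \<mu> (\<lambda>x. T v x - \<rho> * v x) = 0"
      using L2_norm_nonneg by (simp add: antisym)
    from L2_norm_zero_imp_AE[OF DL this] have "AE x in \<mu>. T v x = \<rho> * v x" by simp
    then show ?thesis using v v_pos orth_v by blast
  qed
  then show thesis
    using that[of \<rho>] rho0 ray unfolding V_def by blast
qed

end

text \<open>Together with the list of its eigenvalues. The list need not contain a basis of the kernel, but
  the Fourier series along \<open>\<phi>\<close> converges for every function in the closed range of \<open>T\<close>.\<close>

locale eigen_expansion = compact_positive_op +
  fixes e :: "nat \<Rightarrow> real" and \<phi> :: "nat \<Rightarrow> real \<Rightarrow> real"
  assumes eigen: "eigen_sequence \<mu> T e \<phi>"
begin

lemma eigenfun_L2: "\<phi> j \<in> L2 \<mu>"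
  and eigenfun_orth: "L2_inner \<mu> (\<phi> i) (\<phi> j) = (if i = j then 1 else 0)"
  and eigenfun_eq: "AE x in \<mu>. T (\<phi> j) x = e j * \<phi> j x"
  and eigenval_decseq: "decseq e"
  using eigen unfolding eigen_sequence_def by blast+

lemma eigenspace_spanned:
  assumes "c \<noteq> 0" "f \<in> L2 \<mu>" "AE x in \<mu>. T f x = c * f x"
  shows "\<exists>J a. finite J \<and> J \<subseteq> {j. e j = c} \<and> (AE x in \<mu>. f x = (\<Sum>j\<in>J. a j * \<phi> j x))"
  using eigen assms unfolding eigen_sequence_def by blast

lemma eigenfun_norm: "L2_norm \<mu> (\<phi> j) = 1"
  by (simp add: L2_norm_def eigenfun_orth)

lemma inner_T_eigenfun: "f \<in> L2 \<mu> \<Longrightarrow> L2_inner \<mu> (T f) (\<phi> j) = e j * L2_inner \<mu> f (\<phi> j)"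
proof -
  assume f: "f \<in> L2 \<mu>"
  have "L2_inner \<mu> (T f) (\<phi> j) = L2_inner \<mu> (T (\<phi> j)) f"
    using T_sym[OF f eigenfun_L2] by (simp add: L2_inner_commute)
  also have "\<dots> = L2_inner \<mu> (\<lambda>x. e j * \<phi> j x) f"
    by (intro L2_inner_cong_AE eigenfun_eq T_L2 eigenfun_L2 L2_scale f)
  finally show ?thesis by (simp add: L2_inner_scale_left L2_inner_commute[of "\<phi> j"])
qed

lemma eigenval_nonneg: "0 \<le> e j"
  using T_pos[OF eigenfun_L2, of j] inner_T_eigenfun[OF eigenfun_L2, of j j] by (simp add: eigenfun_orth)

text \<open>Were the eigenvalues bounded below by \<open>L > 0\<close>, the images of the orthonormal eigenfunctions
  would be at mutual distance at least \<open>L\<close>, and no subsequence of them could converge.\<close>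

lemma eigenval_tendsto_0: "e \<longlonglongrightarrow> 0"
proof -
  obtain L where L: "e \<longlonglongrightarrow> L" "\<And>i. L \<le> e i"
    using decseq_convergent[OF eigenval_decseq, of 0] eigenval_nonneg by blast
  have L0: "0 \<le> L" by (rule LIMSEQ_le_const[OF L(1)]) (use eigenval_nonneg in auto)
  have "L = 0"
  proof (rule ccontr)
    assume "L \<noteq> 0"
    then have Lp: "L > 0" using L0 by simp
    obtain r :: "nat \<Rightarrow> nat" and v where r: "strict_mono r" and v: "v \<in> L2 \<mu>"
      and lim: "(\<lambda>n. L2_norm \<mu> (\<lambda>x. T (\<phi> (r n)) x - v x)) \<longlonglongrightarrow> 0"
      using T_compact_L2[of \<phi>, OF eigenfun_L2 eq_refl[OF eigenfun_norm]] .
    obtain N where N: "\<And>n. n \<ge> N \<Longrightarrow> L2_norm \<mu> (\<lambda>x. T (\<phi> (r n)) x - v x) < L / 2"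
      using LIMSEQ_D[OF lim, of "L / 2"] Lp by (auto simp: L2_norm_nonneg)
    define i j where "i = r N" and "j = r (Suc N)"
    have ij: "i \<noteq> j" using strict_mono_eq[OF r] by (simp add: i_def j_def)
    have TL: "T (\<phi> k) \<in> L2 \<mu>" for k by (intro T_L2 eigenfun_L2)
    have "L2_norm \<mu> (\<lambda>x. T (\<phi> i) x - T (\<phi> j) x) < L"
      using L2_triangle_diff[OF TL v TL, of i j] N[of N] N[of "Suc N"]
      by (simp add: i_def j_def L2_norm_minus_commute[of v])
    moreover have "e i = L2_inner \<mu> (\<lambda>x. T (\<phi> i) x - T (\<phi> j) x) (\<phi> i)"
      using ij by (simp add: L2_inner_diff_left TL eigenfun_L2 inner_T_eigenfun eigenfun_orth)
    moreover have "\<dots> \<le> L2_norm \<mu> (\<lambda>x. T (\<phi> i) x - T (\<phi> j) x)"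
      using L2_Cauchy_Schwarz[OF L2_diff[OF TL TL] eigenfun_L2, of i j i] by (simp add: eigenfun_norm)
    ultimately show False using L(2)[of i] by simp
  qed
  then show ?thesis using L(1) by simp
qed

text \<open>The maximum \<open>\<rho>\<close> of the quadratic form on the orthogonal complement of the first \<open>n\<close>
  eigenfunctions is zero or an eigenvalue with an eigenfunction in that complement. Such an
  eigenfunction is a combination of the \<open>\<phi> j\<close> with \<open>e j = \<rho>\<close>, and some \<open>j \<ge> n\<close> must occur in it;
  hence \<open>\<rho> \<le> e n\<close>.\<close>

lemma rayleigh_le:
  assumes f: "f \<in> L2 \<mu>" and orth: "\<And>i. i < n \<Longrightarrow> L2_inner \<mu> f (\<phi> i) = 0"
  shows "L2_inner \<mu> (T f) f \<le> e n * L2_inner \<mu> f f"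
proof -
  obtain \<rho> where rho: "0 \<le> \<rho>"
    "\<forall>f\<in>L2 \<mu>. (\<forall>i<n. L2_inner \<mu> f (\<phi> i) = 0) \<longrightarrow> L2_inner \<mu> (T f) f \<le> \<rho> * L2_inner \<mu> f f"
    "0 < \<rho> \<longrightarrow> (\<exists>v\<in>L2 \<mu>. (\<forall>i<n. L2_inner \<mu> v (\<phi> i) = 0) \<and> L2_norm \<mu> v > 0 \<and>
      (AE x in \<mu>. T v x = \<rho> * v x))"
    using rayleigh_maximum[of n \<phi> e, OF eigenfun_L2 eigenfun_eq] .
  have "\<rho> \<le> e n"
  proof (cases "\<rho> = 0")
    case True
    then show ?thesis using eigenval_nonneg by simp
  next
    case False
    then obtain v where v: "v \<in> L2 \<mu>" "\<And>i. i < n \<Longrightarrow> L2_inner \<mu> v (\<phi> i) = 0" "L2_norm \<mu> v > 0"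
      "AE x in \<mu>. T v x = \<rho> * v x"
      using rho by auto
    obtain J a where J: "finite J" "J \<subseteq> {j. e j = \<rho>}" "AE x in \<mu>. v x = (\<Sum>j\<in>J. a j * \<phi> j x)"
      using eigenspace_spanned[OF False v(1,4)] by blast
    have "\<exists>j\<in>J. n \<le> j"
    proof (rule ccontr)
      assume "\<not> (\<exists>j\<in>J. n \<le> j)"
      then have *: "L2_inner \<mu> (\<phi> j) v = 0" if "j \<in> J" for j
        using v(2) that by (subst L2_inner_commute) (auto simp: not_le)
      have "L2_inner \<mu> v v = L2_inner \<mu> (\<lambda>x. \<Sum>j\<in>J. a j * \<phi> j x) v"
        using J by (intro L2_inner_cong_AE v L2_sum L2_scale eigenfun_L2)
      also have "\<dots> = 0"
        using J(1) * v(1) by (simp add: L2_inner_sum_left L2_scale eigenfun_L2 L2_inner_scale_left)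
      finally show False using v(3) by (simp add: L2_norm_def)
    qed
    then obtain j where "j \<in> J" "n \<le> j" by blast
    then show ?thesis using J(2) decseqD[OF eigenval_decseq] by auto
  qed
  then have "\<rho> * L2_inner \<mu> f f \<le> e n * L2_inner \<mu> f f"
    by (rule mult_right_mono) (rule L2_inner_self_nonneg)
  moreover have "L2_inner \<mu> (T f) f \<le> \<rho> * L2_inner \<mu> f f"
    using rho(2) f orth by blast
  ultimately show ?thesis by linarith
qed

lemmas remainder_L2 = fourier_remainder_L2[of \<phi>, OF eigenfun_L2 eigenfun_orth]
  and remainder_orthogonal = fourier_remainder_orthogonal[of \<phi>, OF eigenfun_L2 eigenfun_orth]
  and norm_remainder_le = norm_fourier_remainder_le[of \<phi>, OF eigenfun_L2 eigenfun_orth]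
  and remainder_diff = fourier_remainder_diff[of \<phi>, OF eigenfun_L2 eigenfun_orth]
  and inner_remainder = inner_fourier_remainder[of \<phi>, OF eigenfun_L2 eigenfun_orth]

lemma inner_T_remainder_le:
  assumes f: "f \<in> L2 \<mu>"
  shows "L2_inner \<mu> (T (fourier_remainder \<phi> n f)) (fourier_remainder \<phi> n f) \<le> e n * (L2_norm \<mu> f)\<^sup>2"
proof -
  let ?r = "fourier_remainder \<phi> n f"
  have "L2_inner \<mu> (T ?r) ?r \<le> e n * (L2_norm \<mu> ?r)\<^sup>2"
    unfolding L2_norm_power2 by (intro rayleigh_le remainder_L2 remainder_orthogonal f)
  also have "\<dots> \<le> e n * (L2_norm \<mu> f)\<^sup>2"
    by (intro mult_left_mono power_mono norm_remainder_le f L2_norm_nonneg eigenval_nonneg)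
  finally show ?thesis .
qed

lemma T_remainder:
  assumes f: "f \<in> L2 \<mu>"
  shows "AE x in \<mu>. fourier_remainder \<phi> n (T f) x = T (fourier_remainder \<phi> n f) x"
proof -
  have "T (fourier_remainder \<phi> n f) = (\<lambda>x. T f x - (\<Sum>i<n. L2_inner \<mu> f (\<phi> i) * T (\<phi> i) x))"
    unfolding fourier_remainder_def
    by (subst T_diff) (auto intro!: f L2_sum L2_scale eigenfun_L2 simp: T_sum T_scale L2_scale eigenfun_L2)
  moreover have "AE x in \<mu>. \<forall>i. T (\<phi> i) x = e i * \<phi> i x"
    using eigenfun_eq by (simp add: AE_all_countable)
  ultimately show ?thesis
    using f by (auto simp: fourier_remainder_def inner_T_eigenfun mult_ac)
qed

lemma inner_T_eigen_sum:
  assumes f: "f \<in> L2 \<mu>"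
  shows "(\<lambda>i. e i * (L2_inner \<mu> f (\<phi> i))\<^sup>2) sums L2_inner \<mu> (T f) f"
proof -
  have eq: "L2_inner \<mu> (T f) f - (\<Sum>i<n. e i * (L2_inner \<mu> f (\<phi> i))\<^sup>2)
      = L2_inner \<mu> (T (fourier_remainder \<phi> n f)) (fourier_remainder \<phi> n f)" for n
  proof -
    let ?r = "fourier_remainder \<phi> n f"
    have r: "?r \<in> L2 \<mu>" by (rule remainder_L2[OF f])
    have "L2_inner \<mu> (T ?r) ?r = L2_inner \<mu> (fourier_remainder \<phi> n (T f)) ?r"
      using T_remainder[OF f, of n] by (intro L2_inner_cong_AE T_L2 r remainder_L2 f) auto
    also have "\<dots> = L2_inner \<mu> (T f) ?r - (\<Sum>i<n. L2_inner \<mu> (T f) (\<phi> i) * L2_inner \<mu> (\<phi> i) ?r)"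
      by (rule inner_remainder[OF T_L2[OF f] r])
    also have "(\<Sum>i<n. L2_inner \<mu> (T f) (\<phi> i) * L2_inner \<mu> (\<phi> i) ?r) = 0"
      using remainder_orthogonal[OF f] by (simp add: L2_inner_commute[of "\<phi> _" ?r])
    also have "L2_inner \<mu> (T f) ?r
      = L2_inner \<mu> f (T f) - (\<Sum>i<n. L2_inner \<mu> f (\<phi> i) * L2_inner \<mu> (\<phi> i) (T f))"
      using inner_remainder[OF f T_L2[OF f], of n] by (simp add: L2_inner_commute[of "T f" ?r])
    also have "\<dots> = L2_inner \<mu> (T f) f - (\<Sum>i<n. e i * (L2_inner \<mu> f (\<phi> i))\<^sup>2)"
      by (simp add: L2_inner_commute[of _ "T f"] inner_T_eigenfun f power2_eq_square mult_ac)
    finally show ?thesis by simp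
  qed
  have "(\<lambda>n. L2_inner \<mu> (T f) f - (\<Sum>i<n. e i * (L2_inner \<mu> f (\<phi> i))\<^sup>2)) \<longlonglongrightarrow> 0"
  proof (rule Lim_null_comparison)
    show "(\<lambda>n. e n * (L2_norm \<mu> f)\<^sup>2) \<longlonglongrightarrow> 0"
      using tendsto_mult_left_zero[OF eigenval_tendsto_0] .
    show "\<forall>\<^sub>F n in sequentially. norm (L2_inner \<mu> (T f) f - (\<Sum>i<n. e i * (L2_inner \<mu> f (\<phi> i))\<^sup>2))
      \<le> e n * (L2_norm \<mu> f)\<^sup>2"
      unfolding eq using inner_T_remainder_le[OF f] T_pos[OF remainder_L2[OF f]] by simp
  qed
  from tendsto_diff[OF tendsto_const[of "L2_inner \<mu> (T f) f"] this] show ?thesis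
    by (simp add: sums_def)
qed

lemma remainder_T_tendsto_0:
  assumes f: "f \<in> L2 \<mu>"
  shows "(\<lambda>n. L2_norm \<mu> (fourier_remainder \<phi> n (T f))) \<longlonglongrightarrow> 0"
proof -
  have "(L2_norm \<mu> (fourier_remainder \<phi> n (T f)))\<^sup>2 \<le> op_bound * (e n * (L2_norm \<mu> f)\<^sup>2)" for n
  proof -
    let ?r = "fourier_remainder \<phi> n f"
    have r: "?r \<in> L2 \<mu>" by (rule remainder_L2[OF f])
    have "L2_norm \<mu> (fourier_remainder \<phi> n (T f)) = L2_norm \<mu> (T ?r)"
      by (intro L2_norm_cong_AE remainder_L2 T_L2 f T_remainder)
    then have "(L2_norm \<mu> (fourier_remainder \<phi> n (T f)))\<^sup>2 \<le> op_bound * L2_inner \<mu> (T ?r) ?r"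
      using norm_T_power2_le[OF r op_bound_pos inner_T_le[OF T_L2[OF r]]] by simp
    also have "\<dots> \<le> op_bound * (e n * (L2_norm \<mu> f)\<^sup>2)"
      using op_bound_pos by (intro mult_left_mono inner_T_remainder_le f) auto
    finally show ?thesis .
  qed
  moreover have "(\<lambda>n. op_bound * (e n * (L2_norm \<mu> f)\<^sup>2)) \<longlonglongrightarrow> 0"
    by (intro tendsto_mult_right_zero tendsto_mult_left_zero eigenval_tendsto_0)
  ultimately show ?thesis by (rule L2_norm_tendsto_0I)
qed

theorem remainder_tendsto_0:
  assumes h: "h \<in> L2_closure \<mu> (T ` L2 \<mu>)"
  shows "(\<lambda>n. L2_norm \<mu> (fourier_remainder \<phi> n h)) \<longlonglongrightarrow> 0"
proof (rule LIMSEQ_I)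
  fix \<epsilon> :: real assume eps: "\<epsilon> > 0"
  have hL: "h \<in> L2 \<mu>" using h by (simp add: L2_closure_def)
  obtain f where f: "f \<in> L2 \<mu>" "L2_norm \<mu> (\<lambda>x. h x - T f x) < \<epsilon> / 2"
    using h half_gt_zero[OF eps] unfolding L2_closure_def by blast
  obtain N where N: "\<And>n. n \<ge> N \<Longrightarrow> L2_norm \<mu> (fourier_remainder \<phi> n (T f)) < \<epsilon> / 2"
    using LIMSEQ_D[OF remainder_T_tendsto_0[OF f(1)] half_gt_zero[OF eps]]
    by (auto simp: L2_norm_nonneg)
  show "\<exists>N. \<forall>n\<ge>N. norm (L2_norm \<mu> (fourier_remainder \<phi> n h) - 0) < \<epsilon>"
  proof (intro exI allI impI)
    fix n assume "N \<le> n"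
    have "L2_norm \<mu> (fourier_remainder \<phi> n h)
      \<le> L2_norm \<mu> (fourier_remainder \<phi> n (\<lambda>x. h x - T f x)) + L2_norm \<mu> (fourier_remainder \<phi> n (T f))"
      using L2_triangle[OF remainder_L2[OF L2_diff[OF hL T_L2[OF f(1)]]] remainder_L2[OF T_L2[OF f(1)]], of n n]
      by (simp add: remainder_diff hL T_L2 f(1))
    also have "\<dots> < \<epsilon> / 2 + \<epsilon> / 2"
      using norm_remainder_le[OF L2_diff[OF hL T_L2[OF f(1)]], of n] f(2) N[OF \<open>N \<le> n\<close>] by linarith
    finally show "norm (L2_norm \<mu> (fourier_remainder \<phi> n h) - 0) < \<epsilon>"
      by (simp add: L2_norm_nonneg)
  qed
qed

text \<open>Membership in the closed range of \<open>T\<close> follows from a bound \<open>\<langle>h, u\<rangle>\<^sup>2 \<le> c \<langle>Tu, u\<rangle>\<close>, which says that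
  \<open>h\<close> lies in the range of the square root of \<open>T\<close>.\<close>

lemma in_closure_range:
  assumes h: "h \<in> L2 \<mu>" and c: "0 \<le> c"
    and le: "\<And>u. u \<in> L2 \<mu> \<Longrightarrow> (L2_inner \<mu> h u)\<^sup>2 \<le> c * L2_inner \<mu> (T u) u"
  shows "h \<in> L2_closure \<mu> (T ` L2 \<mu>)"
proof -
  have bound: "((L2_norm \<mu> (fourier_remainder \<phi> n h))\<^sup>2)\<^sup>2 \<le> c * (e n * (L2_norm \<mu> h)\<^sup>2)" for n
  proof -
    have "((L2_norm \<mu> (fourier_remainder \<phi> n h))\<^sup>2)\<^sup>2 = (L2_inner \<mu> h (fourier_remainder \<phi> n h))\<^sup>2"
      unfolding L2_norm_power2
      using inner_fourier_remainder_self[of \<phi>, OF eigenfun_L2 eigenfun_orth h] by simp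
    also have "\<dots> \<le> c * L2_inner \<mu> (T (fourier_remainder \<phi> n h)) (fourier_remainder \<phi> n h)"
      by (rule le[OF remainder_L2[OF h]])
    also have "\<dots> \<le> c * (e n * (L2_norm \<mu> h)\<^sup>2)"
      by (intro mult_left_mono inner_T_remainder_le h c)
    finally show ?thesis .
  qed
  have lim: "(\<lambda>n. L2_norm \<mu> (fourier_remainder \<phi> n h)) \<longlonglongrightarrow> 0"
  proof (rule L2_norm_tendsto_0I)
    show "(L2_norm \<mu> (fourier_remainder \<phi> n h))\<^sup>2 \<le> sqrt (c * (e n * (L2_norm \<mu> h)\<^sup>2))" for n
      by (intro real_le_rsqrt bound)
    have "(\<lambda>n. c * (e n * (L2_norm \<mu> h)\<^sup>2)) \<longlonglongrightarrow> 0"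
      by (intro tendsto_mult_right_zero tendsto_mult_left_zero eigenval_tendsto_0)
    then show "(\<lambda>n. sqrt (c * (e n * (L2_norm \<mu> h)\<^sup>2))) \<longlonglongrightarrow> 0"
      using tendsto_real_sqrt by fastforce
  qed
  have range: "\<exists>g\<in>T ` L2 \<mu>. L2_norm \<mu> (\<lambda>x. h x - g x) = L2_norm \<mu> (fourier_remainder \<phi> n h)" for n
  proof
    \<comment> \<open>The remainder is \<open>h - T f\<close> for the following \<open>f\<close>: where \<open>e i = 0\<close>, the hypothesis forces the
      coefficient of \<open>h\<close> to vanish.\<close>
    define a where "a = (\<lambda>i. if e i = 0 then 0 else L2_inner \<mu> h (\<phi> i) / e i)"
    define f where "f = (\<lambda>x. \<Sum>i<n. a i * \<phi> i x)"
    have f: "f \<in> L2 \<mu>" unfolding f_def by (intro L2_sum L2_scale eigenfun_L2) simp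
    have Tf: "T f = (\<lambda>x. \<Sum>i<n. a i * T (\<phi> i) x)"
      unfolding f_def by (simp add: T_sum T_scale L2_scale eigenfun_L2)
    have ae: "a i * e i = L2_inner \<mu> h (\<phi> i)" for i
    proof (cases "e i = 0")
      case True
      have "(L2_inner \<mu> h (\<phi> i))\<^sup>2 \<le> 0"
        using le[OF eigenfun_L2, of i] inner_T_eigenfun[OF eigenfun_L2, of i i] True by simp
      then show ?thesis using True by simp
    qed (simp add: a_def)
    show "T f \<in> T ` L2 \<mu>" using f by simp
    have "AE x in \<mu>. \<forall>i. T (\<phi> i) x = e i * \<phi> i x"
      using eigenfun_eq by (simp add: AE_all_countable)
    then have "AE x in \<mu>. h x - T f x = fourier_remainder \<phi> n h x"
    proof eventually_elim
      case (elim x)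
      then show ?case
        by (simp add: Tf fourier_remainder_def mult.assoc[symmetric] ae)
    qed
    then show "L2_norm \<mu> (\<lambda>x. h x - T f x) = L2_norm \<mu> (fourier_remainder \<phi> n h)"
      by (intro L2_norm_cong_AE L2_diff h T_L2 f remainder_L2)
  qed
  show ?thesis
    unfolding L2_closure_def
  proof (intro CollectI conjI allI impI h)
    fix \<epsilon> :: real assume "0 < \<epsilon>"
    then obtain n where "L2_norm \<mu> (fourier_remainder \<phi> n h) < \<epsilon>"
      using LIMSEQ_D[OF lim, of \<epsilon>] by (auto simp: L2_norm_nonneg)
    moreover obtain g where "g \<in> T ` L2 \<mu>"
      "L2_norm \<mu> (\<lambda>x. h x - g x) = L2_norm \<mu> (fourier_remainder \<phi> n h)"
      using range[of n] by blast
    ultimately show "\<exists>g\<in>T ` L2 \<mu>. L2_norm \<mu> (\<lambda>x. h x - g x) < \<epsilon>"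
      by (intro bexI[of _ g]) simp_all
  qed
qed

lemma eigenfun_bounded:
  assumes "e j \<noteq> 0"
  shows "\<exists>C. AE x in \<mu>. \<bar>\<phi> j x\<bar> \<le> C"
proof
  show "AE x in \<mu>. \<bar>\<phi> j x\<bar> \<le> B / \<bar>e j\<bar>"
    using eigenfun_eq[of j]
  proof eventually_elim
    case (elim x)
    then have "\<bar>e j\<bar> * \<bar>\<phi> j x\<bar> \<le> B"
      using T_bound[OF eigenfun_L2, of j x] by (simp add: eigenfun_norm abs_mult)
    then show ?case using assms by (simp add: pos_le_divide_eq mult.commute)
  qed
qed

end

section \<open>Random probability measures and their distribution functions\<close>

lemma topspace_weak_topology: "topspace weak_topology = {\<nu>. real_distribution \<nu>}"
proof -
  have "continuous_on UNIV (\<lambda>x::real. 0::real)" "bounded (range (\<lambda>x::real. 0::real))"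
    by auto
  then have "{\<nu>. real_distribution \<nu>} \<in> {{\<nu>. real_distribution \<nu> \<and> (\<integral>x. f x \<partial>\<nu>) \<in> U} | (f :: real \<Rightarrow> real) U.
        continuous_on UNIV f \<and> bounded (range f) \<and> open U}"
    by (intro CollectI exI[of _ "\<lambda>x. 0"] exI[of _ UNIV]) auto
  then show ?thesis
    unfolding weak_topology_def topology_generated_by_topspace by blast
qed

lemma space_weak_borel: "space weak_borel = {\<nu>. real_distribution \<nu>}"
  by (simp add: weak_borel_def space_measure_of_conv topspace_weak_topology)

lemma openin_weak_borel: "openin weak_topology U \<Longrightarrow> U \<in> sets weak_borel"
  unfolding weak_borel_def by (subst sets_measure_of) (auto dest: openin_subset)

lemma measurable_integral_weak_borel:
  fixes f :: "real \<Rightarrow> real"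
  assumes "continuous_on UNIV f" "bounded (range f)"
  shows "(\<lambda>\<nu>. \<integral>x. f x \<partial>\<nu>) \<in> borel_measurable weak_borel"
proof (rule borel_measurableI)
  fix U :: "real set" assume "open U"
  then have "openin weak_topology {\<nu>. real_distribution \<nu> \<and> (\<integral>x. f x \<partial>\<nu>) \<in> U}"
    unfolding weak_topology_def using assms by (intro topology_generated_by_Basis) blast
  then have "{\<nu>. real_distribution \<nu> \<and> (\<integral>x. f x \<partial>\<nu>) \<in> U} \<in> sets weak_borel"
    by (rule openin_weak_borel)
  moreover have "(\<lambda>\<nu>. \<integral>x. f x \<partial>\<nu>) -` U \<inter> space weak_borel
      = {\<nu>. real_distribution \<nu> \<and> (\<integral>x. f x \<partial>\<nu>) \<in> U}"
    by (auto simp: space_weak_borel)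
  ultimately show "(\<lambda>\<nu>. \<integral>x. f x \<partial>\<nu>) -` U \<inter> space weak_borel \<in> sets weak_borel"
    by simp
qed

lemma cts_step_continuous_bounded:
  assumes "a < b"
  shows "continuous_on UNIV (cts_step a b)" "bounded (range (cts_step a b))"
proof -
  show "continuous_on UNIV (cts_step a b)"
    by (intro uniformly_continuous_imp_continuous cts_step_uniformly_continuous assms)
  have "\<bar>cts_step a b x\<bar> \<le> 1" for x
    using assms by (auto simp: cts_step_def)
  then show "bounded (range (cts_step a b))"
    by (auto simp: bounded_iff)
qed

lemma cts_step_tendsto_cdf:
  assumes "real_distribution \<nu>"
  shows "(\<lambda>n. \<integral>y. cts_step x (x + inverse (real (Suc n))) y \<partial>\<nu>) \<longlonglongrightarrow> cdf \<nu> x"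
proof -
  interpret real_distribution \<nu> by fact
  show ?thesis
  proof (rule tendsto_sandwich)
    show "\<forall>\<^sub>F n in sequentially. cdf \<nu> x \<le> (\<integral>y. cts_step x (x + inverse (real (Suc n))) y \<partial>\<nu>)"
      by (intro always_eventually allI cdf_cts_step) simp
    show "\<forall>\<^sub>F n in sequentially.
        (\<integral>y. cts_step x (x + inverse (real (Suc n))) y \<partial>\<nu>) \<le> cdf \<nu> (x + inverse (real (Suc n)))"
      by (intro always_eventually allI cdf_cts_step) simp
    have "filterlim (\<lambda>n. x + inverse (real (Suc n))) (at_right x) sequentially"
      unfolding filterlim_at
      using tendsto_add[OF tendsto_const[of x] LIMSEQ_inverse_real_of_nat] by simp
    then show "(\<lambda>n. cdf \<nu> (x + inverse (real (Suc n)))) \<longlonglongrightarrow> cdf \<nu> x"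
      using filterlim_compose[OF cdf_is_right_cont[of x, unfolded continuous_within]] by blast
  qed simp
qed

text \<open>The distribution function at a point is a limit of integrals of continuous functions, hence it is
  measurable for the Borel sets of the weak topology.\<close>

lemma measurable_cdf_weak_borel: "(\<lambda>\<nu>. cdf \<nu> x) \<in> borel_measurable weak_borel"
proof (rule borel_measurable_LIMSEQ_real)
  show "(\<lambda>\<nu>. \<integral>y. cts_step x (x + inverse (real (Suc n))) y \<partial>\<nu>) \<in> borel_measurable weak_borel" for n
    by (intro measurable_integral_weak_borel cts_step_continuous_bounded) simp_all
  show "(\<lambda>n. \<integral>y. cts_step x (x + inverse (real (Suc n))) y \<partial>\<nu>) \<longlonglongrightarrow> cdf \<nu> x"
    if "\<nu> \<in> space weak_borel" for \<nu>
    using that by (intro cts_step_tendsto_cdf) (simp add: space_weak_borel)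
qed

text \<open>A random element of the space of probability measures on the line.\<close>

locale random_measure = prob_space M for M :: "'a measure" +
  fixes \<nu> :: "'a \<Rightarrow> real measure"
  assumes measurable_weak: "\<nu> \<in> measurable M weak_borel"
begin

lemma real_distribution: "\<omega> \<in> space M \<Longrightarrow> real_distribution (\<nu> \<omega>)"
  using measurable_space[OF measurable_weak] by (simp add: space_weak_borel)

lemma measurable_cdf[measurable]: "(\<lambda>\<omega>. cdf (\<nu> \<omega>) x) \<in> borel_measurable M"
  using measurable_compose[OF measurable_weak measurable_cdf_weak_borel] .

lemma measurable_prob_algebra: "\<nu> \<in> measurable M (prob_algebra borel)"
proof (rule measurable_prob_algebra_generated)
  show "sets borel = sigma_sets UNIV (range (\<lambda>a::real. {..a}))"
    by (subst borel_eq_atMost) simp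
  show "Int_stable (range (\<lambda>a::real. {..a}))"
    by (auto simp: Int_stable_def)
  show "prob_space (\<nu> \<omega>)" "sets (\<nu> \<omega>) = sets borel" if "\<omega> \<in> space M" for \<omega>
    using real_distribution[OF that]
    by (auto simp: real_distribution_def real_distribution_axioms_def)
  show "(\<lambda>\<omega>. emeasure (\<nu> \<omega>) A) \<in> borel_measurable M" if A: "A \<in> range (\<lambda>a::real. {..a})" for A
  proof -
    obtain a where a: "A = {..a}" using A by blast
    have "emeasure (\<nu> \<omega>) A = ennreal (cdf (\<nu> \<omega>) a)" if "\<omega> \<in> space M" for \<omega>
    proof -
      interpret \<nu>: real_distribution "\<nu> \<omega>" by (rule real_distribution[OF that])
      show ?thesis by (simp add: a cdf_def \<nu>.emeasure_eq_measure)
    qed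
    then show ?thesis by (subst measurable_cong) auto
  qed
qed simp

lemma measurable_subprob: "\<nu> \<in> measurable M (subprob_algebra borel)"
  using measurable_prob_algebra by (rule measurable_prob_algebraD)

lemma measurable_cdf_pair: "(\<lambda>(\<omega>, x). cdf (\<nu> \<omega>) x) \<in> borel_measurable (M \<Otimes>\<^sub>M borel)"
proof -
  have "(\<lambda>p. measure (\<nu> (fst p)) {..snd p}) \<in> borel_measurable (M \<Otimes>\<^sub>M borel)"
  proof (rule measure_measurable_subprob_algebra2)
    have "(SIGMA p:space (M \<Otimes>\<^sub>M (borel :: real measure)). {..snd p})
      = {q \<in> space ((M \<Otimes>\<^sub>M borel) \<Otimes>\<^sub>M borel). snd q \<le> snd (fst q)}"
      by (auto simp: space_pair_measure)
    then show "(SIGMA p:space (M \<Otimes>\<^sub>M borel). {..snd p}) \<in> sets ((M \<Otimes>\<^sub>M borel) \<Otimes>\<^sub>M (borel :: real measure))"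
      by (simp only:) measurable
    show "(\<lambda>p. \<nu> (fst p)) \<in> measurable (M \<Otimes>\<^sub>M borel) (subprob_algebra borel)"
      using measurable_compose[OF measurable_fst measurable_subprob] .
  qed
  then show ?thesis by (simp add: cdf_def split_beta')
qed

text \<open>The baricenter is the mixture \<open>M \<bind> \<nu>\<close>. Uniqueness holds because the integrals of the functions
  \<open>cts_step\<close> determine the distribution function.\<close>

lemma cdf_baricenter: "cdf (baricenter M \<nu>) x = expectation (\<lambda>\<omega>. cdf (\<nu> \<omega>) x)"
proof -
  let ?b = "M \<bind> \<nu>"
  let ?P = "\<lambda>\<rho>. real_distribution \<rho> \<and> (\<forall>f :: real \<Rightarrow> real. continuous_on UNIV f \<and> bounded (range f) \<longrightarrow>
        (\<integral>\<omega>. (\<integral>x. f x \<partial>\<nu> \<omega>) \<partial>M) = (\<integral>x. f x \<partial>\<rho>))"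
  have sets_b: "sets ?b = sets borel"
    using sets_bind[OF sets_kernel[OF measurable_subprob] not_empty] .
  have prob_b: "prob_space ?b"
    using prob_space_bind'[OF _ measurable_prob_algebra] prob_space_axioms
    by (auto simp: space_prob_algebra)
  have dist_b: "real_distribution ?b"
    using prob_b sets_b by (auto simp: real_distribution_def real_distribution_axioms_def)
  have int_b: "(\<integral>\<omega>. (\<integral>x. f x \<partial>\<nu> \<omega>) \<partial>M) = (\<integral>x. f x \<partial>?b)"
    if f: "f \<in> borel_measurable borel" and b: "\<And>x. \<bar>f x\<bar> \<le> c" for f :: "real \<Rightarrow> real" and c
  proof (rule integral_bind[symmetric, where K=borel and B=c and B'=1])
    show "AE \<omega> in M. emeasure (\<nu> \<omega>) (space (\<nu> \<omega>)) \<le> ennreal 1"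
      using real_distribution
      by (intro AE_I2) (simp add: real_distribution_def prob_space.emeasure_space_1)
  qed (use f b measurable_subprob finite_measure_axioms in auto)
  have P: "?P ?b"
  proof (intro conjI allI impI dist_b)
    fix f :: "real \<Rightarrow> real" assume f: "continuous_on UNIV f \<and> bounded (range f)"
    then obtain c where "\<And>x. \<bar>f x\<bar> \<le> c" by (auto simp: bounded_iff)
    with f show "(\<integral>\<omega>. (\<integral>x. f x \<partial>\<nu> \<omega>) \<partial>M) = (\<integral>x. f x \<partial>?b)"
      by (intro int_b borel_measurable_continuous_onI) auto
  qed
  have "baricenter M \<nu> = ?b"
    unfolding baricenter_def
  proof (rule the_equality[of ?P, OF P])
    fix \<rho> assume \<rho>: "?P \<rho>"
    have "cdf \<rho> = cdf ?b"
    proof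
      fix x
      have "(\<integral>y. cts_step x (x + inverse (real (Suc n))) y \<partial>\<rho>)
        = (\<integral>y. cts_step x (x + inverse (real (Suc n))) y \<partial>?b)" for n
        using P \<rho> cts_step_continuous_bounded[of x "x + inverse (real (Suc n))"] by simp
      then show "cdf \<rho> x = cdf ?b x"
        using cts_step_tendsto_cdf[of \<rho> x] cts_step_tendsto_cdf[OF dist_b, of x] \<rho>
        by (auto intro: LIMSEQ_unique)
    qed
    then show "\<rho> = ?b" using \<rho> dist_b by (intro cdf_unique) auto
  qed
  moreover have "expectation (\<lambda>\<omega>. cdf (\<nu> \<omega>) x) = cdf ?b x"
  proof -
    interpret b: real_distribution ?b by (rule dist_b)
    have "expectation (\<lambda>\<omega>. cdf (\<nu> \<omega>) x) = (\<integral>\<omega>. (\<integral>y. indicator {..x} y \<partial>\<nu> \<omega>) \<partial>M)"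
    proof (rule Bochner_Integration.integral_cong)
      fix \<omega> assume "\<omega> \<in> space M"
      then interpret \<nu>: real_distribution "\<nu> \<omega>" by (rule real_distribution)
      show "cdf (\<nu> \<omega>) x = (\<integral>y. indicator {..x} y \<partial>\<nu> \<omega>)" by (simp add: cdf_def)
    qed simp
    also have "\<dots> = (\<integral>y. indicator {..x} y \<partial>?b)"
      by (rule int_b[of _ 1]) (auto simp: indicator_def)
    finally show ?thesis by (simp add: cdf_def)
  qed
  ultimately show ?thesis by simp
qed

end

lemma stationary_distr:
  assumes "prob_space M" "stationary M N X"
  shows "distr M N (X t) = distr M N (X 0)"
proof -
  have X: "X s \<in> measurable M N" for s
    using assms(2) by (simp add: stationary_def)
  have [measurable]: "(\<lambda>\<omega> t. X (t + s) \<omega>) \<in> measurable M (PiM UNIV (\<lambda>_. N))" for s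
    by (intro measurable_PiM_single') (auto intro: X measurable_space[OF X])
  have eq: "distr M N (X s) = distr (distr M (PiM UNIV (\<lambda>_. N)) (\<lambda>\<omega> t. X (t + s) \<omega>)) N (\<lambda>x. x 0)" for s
    by (subst distr_distr) (auto simp: comp_def)
  show ?thesis
    using assms(2) eq[of t] eq[of 0] by (simp add: stationary_def)
qed

section \<open>The covariance operators of a process of distribution functions\<close>

lemma Fubini_bounded:
  fixes g :: "'a \<Rightarrow> 'b \<Rightarrow> real"
  assumes "finite_measure A" "finite_measure B"
    and g[measurable]: "case_prod g \<in> borel_measurable (A \<Otimes>\<^sub>M B)"
    and bound: "\<And>a b. a \<in> space A \<Longrightarrow> b \<in> space B \<Longrightarrow> \<bar>g a b\<bar> \<le> c"
    and u: "integrable B u"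
  shows "(\<integral>a. (\<integral>b. g a b * u b \<partial>B) \<partial>A) = (\<integral>b. (\<integral>a. g a b \<partial>A) * u b \<partial>B)"
proof -
  interpret A: finite_measure A by fact
  interpret B: finite_measure B by fact
  interpret pair_sigma_finite A B ..
  have [measurable]: "u \<in> borel_measurable B" using u by simp
  have le: "\<bar>g a b * u b\<bar> \<le> \<bar>c\<bar> * \<bar>u b\<bar>" if "a \<in> space A" "b \<in> space B" for a b
    using bound[OF that] by (auto simp: abs_mult intro!: mult_right_mono)
  have int: "integrable B (\<lambda>b. g a b * u b)" if a: "a \<in> space A" for a
  proof (rule Bochner_Integration.integrable_bound)
    show "integrable B (\<lambda>b. \<bar>c\<bar> * \<bar>u b\<bar>)" using u by simp
    show "(\<lambda>b. g a b * u b) \<in> borel_measurable B" using a by measurable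
    show "AE b in B. norm (g a b * u b) \<le> norm (\<bar>c\<bar> * \<bar>u b\<bar>)"
      using le[OF a] by (intro AE_I2) simp
  qed
  have "integrable (A \<Otimes>\<^sub>M B) (case_prod (\<lambda>a b. g a b * u b))"
  proof (rule Fubini_integrable)
    show "integrable A (\<lambda>a. \<integral>b. norm (case (a, b) of (a, b) \<Rightarrow> g a b * u b) \<partial>B)"
    proof (rule A.integrable_const_bound)
      show "AE a in A. norm (\<integral>b. norm (case (a, b) of (a, b) \<Rightarrow> g a b * u b) \<partial>B) \<le> (\<integral>b. \<bar>c\<bar> * \<bar>u b\<bar> \<partial>B)"
      proof (rule AE_I2)
        fix a assume a: "a \<in> space A"
        have "(\<integral>b. \<bar>g a b * u b\<bar> \<partial>B) \<le> (\<integral>b. \<bar>c\<bar> * \<bar>u b\<bar> \<partial>B)"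
          using int[OF a] le[OF a] u by (intro integral_mono) auto
        then show "norm (\<integral>b. norm (case (a, b) of (a, b) \<Rightarrow> g a b * u b) \<partial>B) \<le> (\<integral>b. \<bar>c\<bar> * \<bar>u b\<bar> \<partial>B)"
          by simp
      qed
    qed measurable
    show "AE a in A. integrable B (\<lambda>b. case (a, b) of (a, b) \<Rightarrow> g a b * u b)"
      using int by (intro AE_I2) simp
  qed measurable
  from Fubini_integral[OF this] show ?thesis by simp
qed

text \<open>The common setting for the distribution functions \<open>F t \<omega>\<close> of a stationary sequence of random
  measures: \<open>G\<close> is their mean, and \<open>\<mu>\<close> is a finite Borel measure without atoms.\<close>

locale cdf_process = finite_L2 \<mu> + P: prob_space M
  for \<mu> :: "real measure" and M :: "'a measure" +
  fixes F :: "nat \<Rightarrow> 'a \<Rightarrow> real \<Rightarrow> real" and G :: "real \<Rightarrow> real"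
  assumes sets_mu[measurable_cong]: "sets \<mu> = sets borel"
    and no_atoms: "\<And>x. {x} \<in> null_sets \<mu>"
    and F_measurable: "\<And>t. case_prod (F t) \<in> borel_measurable (M \<Otimes>\<^sub>M borel)"
    and F_mono: "\<And>t \<omega>. \<omega> \<in> space M \<Longrightarrow> mono (F t \<omega>)"
    and F_right_cont: "\<And>t \<omega> x. \<omega> \<in> space M \<Longrightarrow> continuous (at_right x) (F t \<omega>)"
    and F_nonneg: "\<And>t \<omega> x. \<omega> \<in> space M \<Longrightarrow> 0 \<le> F t \<omega> x"
    and F_le_1: "\<And>t \<omega> x. \<omega> \<in> space M \<Longrightarrow> F t \<omega> x \<le> 1"
    and F_mean: "\<And>t x. (\<integral>\<omega>. F t \<omega> x \<partial>M) = G x"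
begin

lemma space_mu: "space \<mu> = UNIV"
  using sets_eq_imp_space_eq[OF sets_mu] by simp

lemma F_pair_measurable[measurable]: "case_prod (F t) \<in> borel_measurable (M \<Otimes>\<^sub>M \<mu>)"
  using F_measurable[of t] sets_mu by (subst measurable_cong_sets[OF sets_pair_measure_cong]) auto

lemma F_section_measurable[measurable]: "(\<lambda>\<omega>. F t \<omega> x) \<in> borel_measurable M"
  using measurable_compose[OF measurable_Pair2' F_pair_measurable, of x t] by (simp add: space_mu)

lemma F_integrable: "integrable M (\<lambda>\<omega>. F t \<omega> x)"
  using F_nonneg F_le_1 by (intro P.integrable_const_bound[where B=1] AE_I2) auto

lemma G_mono: "mono G"
proof
  fix x y :: real assume "x \<le> y"
  then have "(\<integral>\<omega>. F 0 \<omega> x \<partial>M) \<le> (\<integral>\<omega>. F 0 \<omega> y \<partial>M)"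
    using F_mono by (intro integral_mono F_integrable) (auto dest: monoD)
  then show "G x \<le> G y" by (simp add: F_mean)
qed

lemma G_measurable[measurable]: "G \<in> borel_measurable \<mu>"
  using borel_measurable_mono[OF G_mono] sets_mu by (simp cong: measurable_cong_sets)

lemma G_range: "0 \<le> G x" "G x \<le> 1"
proof -
  show "0 \<le> G x"
    unfolding F_mean[of 0 x, symmetric] using F_nonneg by (intro integral_nonneg_AE AE_I2) auto
  have "(\<integral>\<omega>. F 0 \<omega> x \<partial>M) \<le> (\<integral>\<omega>. 1 \<partial>M)"
    using F_le_1 by (intro integral_mono F_integrable) auto
  then show "G x \<le> 1" by (simp add: F_mean P.prob_space)
qed

text \<open>The deviation of a distribution function from the mean.\<close>

definition dev :: "nat \<Rightarrow> 'a \<Rightarrow> real \<Rightarrow> real" where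
  "dev t \<omega> x = F t \<omega> x - G x"

text \<open>The inner product of the random deviation with a fixed function \<open>u\<close>, as an operator from
  \<open>L\<^sup>2(\<mu>)\<close> to random variables.\<close>

definition pairing :: "nat \<Rightarrow> (real \<Rightarrow> real) \<Rightarrow> 'a \<Rightarrow> real" where
  "pairing t u \<omega> = (\<integral>x. dev t \<omega> x * u x \<partial>\<mu>)"

text \<open>The adjoint of \<open>pairing t\<close>. The operator with kernel \<open>E[dev s x dev t y]\<close> is the composition
  of \<open>pairing_adj s\<close> and \<open>pairing t\<close>.\<close>

definition pairing_adj :: "nat \<Rightarrow> ('a \<Rightarrow> real) \<Rightarrow> real \<Rightarrow> real" where
  "pairing_adj t Z x = (\<integral>\<omega>. dev t \<omega> x * Z \<omega> \<partial>M)"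

text \<open>The norm of the constant function \<open>1\<close>, which bounds the norm of every deviation.\<close>

definition mass_root :: real where
  "mass_root = sqrt (measure \<mu> (space \<mu>))"

lemma mass_root_nonneg: "0 \<le> mass_root"
  by (simp add: mass_root_def)

lemma dev_measurable[measurable]: "case_prod (dev t) \<in> borel_measurable (M \<Otimes>\<^sub>M \<mu>)"
  unfolding dev_def by measurable

lemma dev_section_measurable[measurable]: "(\<lambda>\<omega>. dev t \<omega> x) \<in> borel_measurable M"
  unfolding dev_def by measurable

lemma dev_bound: "\<omega> \<in> space M \<Longrightarrow> \<bar>dev t \<omega> x\<bar> \<le> 1"
  using F_nonneg[of \<omega> t x] F_le_1[of \<omega> t x] G_range[of x] by (simp add: dev_def)

lemma dev_path_measurable: "\<omega> \<in> space M \<Longrightarrow> dev t \<omega> \<in> borel_measurable \<mu>"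
  using measurable_compose[OF measurable_Pair1' dev_measurable] by simp

lemma dev_L2: "\<omega> \<in> space M \<Longrightarrow> dev t \<omega> \<in> L2 \<mu>"
  by (intro L2_bounded[where c=1] AE_I2 dev_bound dev_path_measurable)

lemma norm_dev_le: "\<omega> \<in> space M \<Longrightarrow> L2_norm \<mu> (dev t \<omega>) \<le> mass_root"
  using L2_norm_le_bound[of "dev t \<omega>" 1] dev_path_measurable dev_bound by (simp add: mass_root_def)

lemma dev_mean: "(\<integral>\<omega>. dev t \<omega> x \<partial>M) = 0"
  unfolding dev_def using F_integrable by (simp add: F_mean P.prob_space)

lemma pairing_measurable[measurable]:
  assumes "u \<in> L2 \<mu>"
  shows "pairing t u \<in> borel_measurable M"
proof -
  have [measurable]: "u \<in> borel_measurable \<mu>" using assms by (rule L2_D)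
  show ?thesis unfolding pairing_def by measurable
qed

lemma pairing_bound:
  assumes "u \<in> L2 \<mu>" "\<omega> \<in> space M"
  shows "\<bar>pairing t u \<omega>\<bar> \<le> mass_root * L2_norm \<mu> u"
proof -
  have "\<bar>pairing t u \<omega>\<bar> \<le> L2_norm \<mu> (dev t \<omega>) * L2_norm \<mu> u"
    using L2_Cauchy_Schwarz[OF dev_L2[OF assms(2)] assms(1)] by (simp add: pairing_def L2_inner_def)
  also have "\<dots> \<le> mass_root * L2_norm \<mu> u"
    by (intro mult_right_mono norm_dev_le assms L2_norm_nonneg)
  finally show ?thesis .
qed

lemma pairing_add:
  assumes "u \<in> L2 \<mu>" "v \<in> L2 \<mu>" "\<omega> \<in> space M"
  shows "pairing t (\<lambda>x. u x + v x) \<omega> = pairing t u \<omega> + pairing t v \<omega>"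
  using L2_inner_add_right[OF assms(1,2) dev_L2[OF assms(3)]] by (simp add: pairing_def L2_inner_def)

lemma pairing_scale: "pairing t (\<lambda>x. c * u x) \<omega> = c * pairing t u \<omega>"
  using L2_inner_scale_right[of "dev t \<omega>" c u] by (simp add: pairing_def L2_inner_def)

lemma bounded_integrable:
  fixes Z :: "'a \<Rightarrow> real"
  assumes "Z \<in> borel_measurable M" "\<And>\<omega>. \<omega> \<in> space M \<Longrightarrow> \<bar>Z \<omega>\<bar> \<le> c"
  shows "integrable M Z"
  using assms by (intro P.integrable_const_bound[where B=c] AE_I2) auto

context
  fixes Z :: "'a \<Rightarrow> real" and c :: real
  assumes Z[measurable]: "Z \<in> borel_measurable M"
    and Z_bound: "\<And>\<omega>. \<omega> \<in> space M \<Longrightarrow> \<bar>Z \<omega>\<bar> \<le> c"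
begin

lemma dev_mult_bound: "\<omega> \<in> space M \<Longrightarrow> \<bar>dev t \<omega> x * Z \<omega>\<bar> \<le> c"
  using mult_mono[OF dev_bound Z_bound, of \<omega> \<omega> t x] by (simp add: abs_mult)

lemma dev_mult_integrable: "integrable M (\<lambda>\<omega>. dev t \<omega> x * Z \<omega>)"
  by (rule bounded_integrable[OF _ dev_mult_bound]) measurable

lemma pairing_adj_measurable: "pairing_adj t Z \<in> borel_measurable \<mu>"
  unfolding pairing_adj_def by measurable

lemma pairing_adj_bound: "\<bar>pairing_adj t Z x\<bar> \<le> c"
proof -
  have "\<bar>pairing_adj t Z x\<bar> \<le> (\<integral>\<omega>. \<bar>dev t \<omega> x * Z \<omega>\<bar> \<partial>M)"
    unfolding pairing_adj_def by (rule integral_abs_bound)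
  also have "\<dots> \<le> (\<integral>\<omega>. c \<partial>M)"
    using dev_mult_integrable dev_mult_bound by (intro integral_mono) auto
  finally show ?thesis by (simp add: P.prob_space)
qed

lemma pairing_adj_L2: "pairing_adj t Z \<in> L2 \<mu>"
  by (intro L2_bounded[where c=c] AE_I2 pairing_adj_bound pairing_adj_measurable)

lemma norm_pairing_adj_le: "0 \<le> c \<Longrightarrow> L2_norm \<mu> (pairing_adj t Z) \<le> mass_root * c"
  using L2_norm_le_bound[OF pairing_adj_measurable _ pairing_adj_bound]
  by (simp add: mass_root_def mult.commute)

lemma pairing_adjoint:
  assumes u: "u \<in> L2 \<mu>"
  shows "(\<integral>\<omega>. Z \<omega> * pairing t u \<omega> \<partial>M) = L2_inner \<mu> (pairing_adj t Z) u"
proof -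
  have "(\<integral>\<omega>. (\<integral>x. (dev t \<omega> x * Z \<omega>) * u x \<partial>\<mu>) \<partial>M) = (\<integral>x. (\<integral>\<omega>. dev t \<omega> x * Z \<omega> \<partial>M) * u x \<partial>\<mu>)"
    by (rule Fubini_bounded[where c=c])
      (use P.finite_measure_axioms finite_measure_axioms L2_integrable[OF u] dev_mult_bound in auto)
  moreover have "(\<integral>x. (dev t \<omega> x * Z \<omega>) * u x \<partial>\<mu>) = Z \<omega> * pairing t u \<omega>" for \<omega>
    unfolding pairing_def integral_mult_right_zero[symmetric] by (simp add: mult_ac)
  ultimately show ?thesis by (simp add: L2_inner_def pairing_adj_def)
qed

end

lemma covariance_kernel:
  assumes u: "u \<in> L2 \<mu>"
  shows "(\<integral>y. (\<integral>\<omega>. dev s \<omega> x * dev t \<omega> y \<partial>M) * u y \<partial>\<mu>) = pairing_adj s (pairing t u) x"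
  using pairing_adjoint[of "\<lambda>\<omega>. dev s \<omega> x" 1 u t] u dev_bound
  by (simp add: L2_inner_def pairing_adj_def mult.commute)

lemma pairing_mean:
  assumes u: "u \<in> L2 \<mu>"
  shows "integrable M (pairing t u)" "(\<integral>\<omega>. pairing t u \<omega> \<partial>M) = 0"
proof -
  show "integrable M (pairing t u)"
    by (rule bounded_integrable[OF pairing_measurable[OF u] pairing_bound[OF u]])
  show "(\<integral>\<omega>. pairing t u \<omega> \<partial>M) = 0"
    using pairing_adjoint[of "\<lambda>_. 1" 1 u t] u dev_mean by (simp add: L2_inner_def pairing_adj_def)
qed

lemma pairing_mult:
  assumes u: "u \<in> L2 \<mu>" and v: "v \<in> L2 \<mu>"
  shows "integrable M (\<lambda>\<omega>. pairing s u \<omega> * pairing t v \<omega>)"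
    "(\<integral>\<omega>. pairing s u \<omega> * pairing t v \<omega> \<partial>M) = L2_inner \<mu> (pairing_adj t (pairing s u)) v"
proof -
  show "integrable M (\<lambda>\<omega>. pairing s u \<omega> * pairing t v \<omega>)"
  proof (rule bounded_integrable)
    show "\<bar>pairing s u \<omega> * pairing t v \<omega>\<bar> \<le> (mass_root * L2_norm \<mu> u) * (mass_root * L2_norm \<mu> v)"
      if "\<omega> \<in> space M" for \<omega>
      unfolding abs_mult using that u v
      by (intro mult_mono pairing_bound) (auto simp: mass_root_nonneg L2_norm_nonneg)
  qed (use u v in measurable)
  show "(\<integral>\<omega>. pairing s u \<omega> * pairing t v \<omega> \<partial>M) = L2_inner \<mu> (pairing_adj t (pairing s u)) v"
    by (rule pairing_adjoint[OF pairing_measurable[OF u] pairing_bound[OF u] v])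
qed

text \<open>By the adjoint relation the left-hand side is \<open>(E[Z pairing t u])\<^sup>2\<close>, and the form on the
  right-hand side is \<open>E[(pairing t u)\<^sup>2]\<close>. This bound puts \<open>pairing_adj t Z\<close> in the closed range of
  the covariance operator.\<close>

lemma pairing_adj_inner_power2_le:
  assumes Z[measurable]: "Z \<in> borel_measurable M"
    and Z_bound: "\<And>\<omega>. \<omega> \<in> space M \<Longrightarrow> \<bar>Z \<omega>\<bar> \<le> c" and u: "u \<in> L2 \<mu>"
  shows "(L2_inner \<mu> (pairing_adj t Z) u)\<^sup>2 \<le> c\<^sup>2 * L2_inner \<mu> (pairing_adj t (pairing t u)) u"
proof -
  define X where "X = (\<lambda>\<omega>. Z \<omega> * pairing t u \<omega>)"
  have [measurable]: "pairing t u \<in> borel_measurable M" by (rule pairing_measurable[OF u])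
  have X[measurable]: "X \<in> borel_measurable M" unfolding X_def by measurable
  have le: "(X \<omega>)\<^sup>2 \<le> c\<^sup>2 * (pairing t u \<omega>)\<^sup>2" if "\<omega> \<in> space M" for \<omega>
    using Z_bound[OF that] abs_le_square_iff[of "Z \<omega>" c]
    unfolding X_def power_mult_distrib by (intro mult_right_mono) auto
  have int2: "integrable M (\<lambda>\<omega>. c\<^sup>2 * (pairing t u \<omega>)\<^sup>2)"
    using pairing_mult(1)[OF u u, of t t] by (simp add: power2_eq_square)
  have X2: "integrable M (\<lambda>\<omega>. (X \<omega>)\<^sup>2)"
    by (rule Bochner_Integration.integrable_bound[OF int2]) (use le in \<open>auto intro!: AE_I2\<close>)
  have X1: "integrable M X"
    by (rule P.square_integrable_imp_integrable[OF X X2])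
  have "(L2_inner \<mu> (pairing_adj t Z) u)\<^sup>2 = (\<integral>\<omega>. X \<omega> \<partial>M)\<^sup>2"
    unfolding X_def by (simp add: pairing_adjoint[OF Z Z_bound u])
  also have "\<dots> \<le> (\<integral>\<omega>. (X \<omega>)\<^sup>2 \<partial>M)"
    using P.variance_positive[of X] P.variance_eq[OF X1 X2] by simp
  also have "\<dots> \<le> (\<integral>\<omega>. c\<^sup>2 * (pairing t u \<omega>)\<^sup>2 \<partial>M)"
    by (intro integral_mono X2 int2 le)
  also have "\<dots> = c\<^sup>2 * L2_inner \<mu> (pairing_adj t (pairing t u)) u"
    using pairing_mult(2)[OF u u, of t t] by (simp add: power2_eq_square)
  finally show ?thesis .
qed

text \<open>Compactness: up to a multiple of \<open>G\<close>, the functions \<open>E[dev Z]\<close> with \<open>Z\<close> in a bounded set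
  are uniformly bounded right-continuous increasing functions, to which Helly's theorem applies;
  the limit has countably many discontinuities, which \<open>\<mu>\<close> does not charge.\<close>

lemma pairing_adj_compact:
  fixes Z :: "nat \<Rightarrow> 'a \<Rightarrow> real"
  assumes Z[measurable]: "\<And>n. Z n \<in> borel_measurable M"
    and Z_bound: "\<And>n \<omega>. \<omega> \<in> space M \<Longrightarrow> \<bar>Z n \<omega>\<bar> \<le> c"
  shows "\<exists>(r :: nat \<Rightarrow> nat) v. strict_mono r \<and> v \<in> borel_measurable \<mu> \<and>
    (AE x in \<mu>. (\<lambda>n. pairing_adj t (Z (r n)) x) \<longlonglongrightarrow> v x)"
proof -
  define m where "m = (\<lambda>n. \<integral>\<omega>. Z n \<omega> \<partial>M)"
  \<comment> \<open>The shift by \<open>2 * c\<close> makes the centred variable \<open>Z n - m n\<close> nonnegative.\<close>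
  define Y where "Y = (\<lambda>n \<omega>. Z n \<omega> - m n + 2 * c)"
  define f where "f = (\<lambda>n x. \<integral>\<omega>. F t \<omega> x * Y n \<omega> \<partial>M)"
  have Z_int: "integrable M (Z n)" for n
    by (rule bounded_integrable[OF Z Z_bound])
  have m_bound: "\<bar>m n\<bar> \<le> c" for n
  proof -
    have "\<bar>m n\<bar> \<le> (\<integral>\<omega>. \<bar>Z n \<omega>\<bar> \<partial>M)" unfolding m_def by (rule integral_abs_bound)
    also have "\<dots> \<le> (\<integral>\<omega>. c \<partial>M)" using Z_int Z_bound by (intro integral_mono) auto
    finally show ?thesis by (simp add: P.prob_space)
  qed
  have Y_meas[measurable]: "Y n \<in> borel_measurable M" for n unfolding Y_def by measurable
  have Y_range: "0 \<le> Y n \<omega>" "Y n \<omega> \<le> 4 * c" if "\<omega> \<in> space M" for n \<omega>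
    using Z_bound[OF that, of n] m_bound[of n] by (auto simp: Y_def)
  have FY_bound: "\<bar>F t \<omega> x * Y n \<omega>\<bar> \<le> 4 * c" if "\<omega> \<in> space M" for n \<omega> x
    using mult_mono[OF F_le_1[OF that] Y_range(2)[OF that] _ Y_range(1)[OF that]]
      F_nonneg[OF that] Y_range[OF that] by (simp add: abs_mult)
  have FY_int: "integrable M (\<lambda>\<omega>. F t \<omega> x * Y n \<omega>)" for n x
    by (rule bounded_integrable[OF _ FY_bound]) measurable
  have f_eq: "pairing_adj t (Z n) x = f n x - 2 * c * G x" for n x
  proof -
    have FZ: "integrable M (\<lambda>\<omega>. F t \<omega> x * Z n \<omega>)"
    proof (rule bounded_integrable)
      show "\<bar>F t \<omega> x * Z n \<omega>\<bar> \<le> c" if "\<omega> \<in> space M" for \<omega>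
        using mult_mono[OF F_le_1[of \<omega> t x] Z_bound[of \<omega> n]] that F_nonneg[of \<omega> t x]
        by (simp add: abs_mult)
    qed measurable
    have "pairing_adj t (Z n) x = (\<integral>\<omega>. F t \<omega> x * Z n \<omega> - G x * Z n \<omega> \<partial>M)"
      by (simp add: pairing_adj_def dev_def left_diff_distrib)
    also have "\<dots> = (\<integral>\<omega>. F t \<omega> x * Z n \<omega> \<partial>M) - G x * m n"
      using FZ Z_int by (simp add: m_def)
    finally have 1: "pairing_adj t (Z n) x = (\<integral>\<omega>. F t \<omega> x * Z n \<omega> \<partial>M) - G x * m n" .
    have "f n x = (\<integral>\<omega>. F t \<omega> x * Z n \<omega> + (2 * c - m n) * F t \<omega> x \<partial>M)"
      unfolding f_def Y_def by (rule Bochner_Integration.integral_cong) (auto simp: algebra_simps)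
    also have "\<dots> = (\<integral>\<omega>. F t \<omega> x * Z n \<omega> \<partial>M) + (2 * c - m n) * G x"
      using FZ F_integrable by (simp add: F_mean)
    finally show ?thesis using 1 by (simp add: algebra_simps)
  qed
  have "\<exists>s. strict_mono (s :: nat \<Rightarrow> nat) \<and> (\<exists>H. (\<forall>x. continuous (at_right x) H) \<and> mono H \<and>
    (\<forall>x. \<bar>H x\<bar> \<le> 4 * c) \<and> (\<forall>x. continuous (at x) H \<longrightarrow> (\<lambda>n. f (s n) x) \<longlonglongrightarrow> H x))"
  proof (rule Helly_selection)
    fix n :: nat and x :: real
    show "continuous (at_right x) (f n)"
      unfolding continuous_within
    proof (rule tendsto_at_right_sequentially[where b="x + 1"])
      fix y :: "nat \<Rightarrow> real" assume y: "\<And>k. x < y k" "y \<longlonglongrightarrow> x"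
      show "(\<lambda>k. f n (y k)) \<longlonglongrightarrow> f n x"
        unfolding f_def
      proof (rule integral_dominated_convergence[where w="\<lambda>_. 4 * c"])
        show "AE \<omega> in M. (\<lambda>k. F t \<omega> (y k) * Y n \<omega>) \<longlonglongrightarrow> F t \<omega> x * Y n \<omega>"
        proof (rule AE_I2)
          fix \<omega> assume \<omega>: "\<omega> \<in> space M"
          have "filterlim y (at_right x) sequentially"
            using y by (auto simp: filterlim_at intro!: always_eventually)
          then have "(\<lambda>k. F t \<omega> (y k)) \<longlonglongrightarrow> F t \<omega> x"
            using filterlim_compose[OF F_right_cont[OF \<omega>, of x t, unfolded continuous_within]] by blast
          then show "(\<lambda>k. F t \<omega> (y k) * Y n \<omega>) \<longlonglongrightarrow> F t \<omega> x * Y n \<omega>"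
            by (intro tendsto_intros)
        qed
        show "AE \<omega> in M. norm (F t \<omega> (y k) * Y n \<omega>) \<le> 4 * c" for k
          by (intro AE_I2) (simp add: FY_bound)
      qed auto
    qed simp
    show "mono (f n)"
    proof
      fix x y :: real assume "x \<le> y"
      then show "f n x \<le> f n y"
        unfolding f_def using Y_range(1)
        by (intro integral_mono FY_int mult_right_mono monoD[OF F_mono]) auto
    qed
    have "\<bar>f n x\<bar> \<le> (\<integral>\<omega>. \<bar>F t \<omega> x * Y n \<omega>\<bar> \<partial>M)" unfolding f_def by (rule integral_abs_bound)
    also have "\<dots> \<le> (\<integral>\<omega>. 4 * c \<partial>M)" using FY_int FY_bound by (intro integral_mono) auto
    finally show "\<bar>f n x\<bar> \<le> 4 * c" by (simp add: P.prob_space)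
  qed
  then obtain s :: "nat \<Rightarrow> nat" and H where s: "strict_mono s" and H: "mono H"
    and lim: "\<And>x. continuous (at x) H \<Longrightarrow> (\<lambda>n. f (s n) x) \<longlonglongrightarrow> H x"
    by blast
  have "(\<Union>x\<in>{x. \<not> isCont H x}. {x}) \<in> null_sets \<mu>"
    by (intro null_sets_UN' mono_ctble_discont[OF H] no_atoms)
  then have "AE x in \<mu>. isCont H x"
    by (rule AE_I') auto
  then have "AE x in \<mu>. (\<lambda>n. pairing_adj t (Z (s n)) x) \<longlonglongrightarrow> H x - 2 * c * G x"
    by eventually_elim (auto simp: f_eq intro!: tendsto_intros lim)
  moreover have "(\<lambda>x. H x - 2 * c * G x) \<in> borel_measurable \<mu>"
  proof -
    have [measurable]: "H \<in> borel_measurable \<mu>"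
      using borel_measurable_mono[OF H] sets_mu by (simp cong: measurable_cong_sets)
    show ?thesis by measurable
  qed
  ultimately show ?thesis using s by blast
qed

text \<open>Every operator that factors through \<open>pairing_adj t\<close> with bounded random variables inherits
  compactness from it.\<close>

lemma compact_positive_opI:
  assumes Z_meas: "\<And>u. u \<in> L2 \<mu> \<Longrightarrow> Z u \<in> borel_measurable M"
    and Z_bound: "\<And>u \<omega>. u \<in> L2 \<mu> \<Longrightarrow> \<omega> \<in> space M \<Longrightarrow> \<bar>Z u \<omega>\<bar> \<le> c * L2_norm \<mu> u"
    and c: "0 \<le> c"
    and Z_add: "\<And>u v \<omega>. u \<in> L2 \<mu> \<Longrightarrow> v \<in> L2 \<mu> \<Longrightarrow> \<omega> \<in> space M \<Longrightarrow> Z (\<lambda>x. u x + v x) \<omega> = Z u \<omega> + Z v \<omega>"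
    and Z_scale: "\<And>u a \<omega>. u \<in> L2 \<mu> \<Longrightarrow> \<omega> \<in> space M \<Longrightarrow> Z (\<lambda>x. a * u x) \<omega> = a * Z u \<omega>"
    and T: "\<And>u. u \<in> L2 \<mu> \<Longrightarrow> T u = pairing_adj t (Z u)"
    and sym: "\<And>u v. u \<in> L2 \<mu> \<Longrightarrow> v \<in> L2 \<mu> \<Longrightarrow> L2_inner \<mu> (T u) v = L2_inner \<mu> u (T v)"
    and pos: "\<And>u. u \<in> L2 \<mu> \<Longrightarrow> 0 \<le> L2_inner \<mu> (T u) u"
  shows "compact_positive_op \<mu> T c"
proof
  fix f g :: "real \<Rightarrow> real" and x a :: real
  assume f: "f \<in> L2 \<mu>"
  show "T f \<in> borel_measurable \<mu>"
    unfolding T[OF f] by (rule pairing_adj_measurable[OF Z_meas[OF f] Z_bound[OF f]])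
  show "\<bar>T f x\<bar> \<le> c * L2_norm \<mu> f"
    unfolding T[OF f] by (rule pairing_adj_bound[OF Z_meas[OF f] Z_bound[OF f]])
  have int: "integrable M (\<lambda>\<omega>. dev t \<omega> y * Z h \<omega>)" if h: "h \<in> L2 \<mu>" for h y
    by (rule dev_mult_integrable[OF Z_meas[OF h] Z_bound[OF h]])
  show "T (\<lambda>x. a * f x) = (\<lambda>x. a * T f x)"
  proof
    fix y
    have "pairing_adj t (Z (\<lambda>x. a * f x)) y = (\<integral>\<omega>. a * (dev t \<omega> y * Z f \<omega>) \<partial>M)"
      unfolding pairing_adj_def using f
      by (intro Bochner_Integration.integral_cong) (auto simp: Z_scale)
    then show "T (\<lambda>x. a * f x) y = a * T f y"
      using f by (simp add: T L2_scale pairing_adj_def)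
  qed
  assume g: "g \<in> L2 \<mu>"
  show "T (\<lambda>x. f x + g x) = (\<lambda>x. T f x + T g x)"
  proof
    fix y
    have "pairing_adj t (Z (\<lambda>x. f x + g x)) y
      = (\<integral>\<omega>. dev t \<omega> y * Z f \<omega> + dev t \<omega> y * Z g \<omega> \<partial>M)"
      unfolding pairing_adj_def using f g
      by (intro Bochner_Integration.integral_cong) (auto simp: Z_add distrib_left)
    then show "T (\<lambda>x. f x + g x) y = T f y + T g y"
      using f g int by (simp add: T L2_add pairing_adj_def)
  qed
next
  fix u :: "nat \<Rightarrow> real \<Rightarrow> real"
  assume u: "\<And>n. u n \<in> L2 \<mu>" and u1: "\<And>n. L2_norm \<mu> (u n) \<le> 1"
  have "\<bar>Z (u n) \<omega>\<bar> \<le> c" if "\<omega> \<in> space M" for n \<omega>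
    using Z_bound[OF u that, of n] mult_left_mono[OF u1 c, of n] by simp
  from pairing_adj_compact[of "\<lambda>n. Z (u n)", OF Z_meas[OF u] this, of t]
  show "\<exists>(r :: nat \<Rightarrow> nat) v. strict_mono r \<and> v \<in> borel_measurable \<mu> \<and>
        (AE x in \<mu>. (\<lambda>n. T (u (r n)) x) \<longlonglongrightarrow> v x)"
    by (simp add: T u)
qed (use c sym pos in auto)

lemma covariance_op_compact_positive:
  assumes T: "\<And>u. u \<in> L2 \<mu> \<Longrightarrow> T u = pairing_adj t (pairing t u)"
  shows "compact_positive_op \<mu> T mass_root"
proof (rule compact_positive_opI[of "pairing t" mass_root T t])
  have inner: "L2_inner \<mu> (T u) v = (\<integral>\<omega>. pairing t u \<omega> * pairing t v \<omega> \<partial>M)"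
    if "u \<in> L2 \<mu>" "v \<in> L2 \<mu>" for u v
    using pairing_mult(2)[OF that] T[OF that(1)] by simp
  show "L2_inner \<mu> (T u) v = L2_inner \<mu> u (T v)" if "u \<in> L2 \<mu>" "v \<in> L2 \<mu>" for u v
    using inner[OF that] inner[OF that(2,1)] by (simp add: L2_inner_commute[of u] mult.commute)
  show "0 \<le> L2_inner \<mu> (T u) u" if "u \<in> L2 \<mu>" for u
    by (simp add: inner that)
qed (use T mass_root_nonneg in \<open>auto simp: pairing_add pairing_scale intro: pairing_bound\<close>)

end

section \<open>Almost every path lies in the closed range of the covariance operator\<close>

lemma sets_Collect_map_eq:
  assumes f: "\<And>i. f i \<in> measurable M (count_space UNIV)"
  shows "{\<omega>\<in>space M. map (\<lambda>i. f i \<omega>) xs = l} \<in> sets M"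
proof (induction xs arbitrary: l)
  case (Cons a xs)
  show ?case
  proof (cases l)
    case (Cons b l')
    have "{\<omega>\<in>space M. map (\<lambda>i. f i \<omega>) (a # xs) = l}
      = (f a -` {b} \<inter> space M) \<inter> {\<omega>\<in>space M. map (\<lambda>i. f i \<omega>) xs = l'}"
      using Cons by auto
    then show ?thesis using Cons.IH[of l'] measurable_sets[OF f, of "{b}" a] by simp
  qed simp
qed (cases l, auto)

text \<open>A random variable with countably many values almost surely takes a value of positive
  probability.\<close>

lemma (in prob_space) AE_fibre_measure_pos:
  fixes X :: "'a \<Rightarrow> 'c :: countable"
  assumes X: "\<And>l. {\<omega>\<in>space M. X \<omega> = l} \<in> sets M"
  shows "AE \<omega> in M. 0 < measure M {\<omega>'\<in>space M. X \<omega>' = X \<omega>}"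
proof -
  have "AE \<omega> in M. X \<omega> = l \<longrightarrow> 0 < measure M {\<omega>'\<in>space M. X \<omega>' = l}" for l
  proof (cases "0 < measure M {\<omega>'\<in>space M. X \<omega>' = l}")
    case False
    then have "measure M {\<omega>'\<in>space M. X \<omega>' = l} = 0"
      using measure_nonneg[of M "{\<omega>'\<in>space M. X \<omega>' = l}"] by linarith
    then have "{\<omega>'\<in>space M. X \<omega>' = l} \<in> null_sets M"
      using X by (simp add: null_sets_def emeasure_eq_measure)
    from AE_not_in[OF this] AE_space show ?thesis by eventually_elim auto
  qed simp
  then have "AE \<omega> in M. \<forall>l. X \<omega> = l \<longrightarrow> 0 < measure M {\<omega>'\<in>space M. X \<omega>' = l}"
    unfolding AE_all_countable by blast
  then show ?thesis by eventually_elim blast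
qed

context cdf_process
begin

text \<open>The values of a distribution function on the grid of mesh \<open>1 / (m + 1)\<close> in the interval
  \<open>[- (m + 1), m + 1]\<close>, rounded to multiples of \<open>1 / (m + 1)\<close>.\<close>

definition grid_label :: "nat \<Rightarrow> nat \<Rightarrow> 'a \<Rightarrow> int list" where
  "grid_label t m \<omega> = map (\<lambda>i. \<lfloor>real (Suc m) * F t \<omega> (real_of_int i / real (Suc m))\<rfloor>)
     [- (int (Suc m))\<^sup>2..(int (Suc m))\<^sup>2]"

text \<open>The event of having the same label as \<open>\<omega>\<close>.\<close>

definition grid_event :: "nat \<Rightarrow> nat \<Rightarrow> 'a \<Rightarrow> 'a set" where
  "grid_event t m \<omega> = {\<omega>'\<in>space M. grid_label t m \<omega>' = grid_label t m \<omega>}"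

lemma grid_label_measurable: "{\<omega>\<in>space M. grid_label t m \<omega> = l} \<in> sets M"
  unfolding grid_label_def by (rule sets_Collect_map_eq) measurable

lemma AE_grid_event_pos: "AE \<omega> in M. \<forall>m. 0 < measure M (grid_event t m \<omega>)"
  unfolding AE_all_countable grid_event_def
  by (intro allI P.AE_fibre_measure_pos grid_label_measurable)

text \<open>By monotonicity, two distribution functions with the same label differ between neighbouring
  grid points by at most the mesh plus the increment of one of them. The bound \<open>m\<close> on \<open>\<bar>x\<bar>\<close> keeps
  both neighbours of \<open>x\<close> on the grid.\<close>

lemma grid_event_close:
  assumes \<omega>: "\<omega> \<in> space M" and \<omega>': "\<omega>' \<in> grid_event t m \<omega>" and x: "\<bar>x\<bar> \<le> real m"
  shows "\<bar>F t \<omega>' x - F t \<omega> x\<bar> \<le> 1 / real (Suc m)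
    + (F t \<omega> ((real_of_int \<lfloor>real (Suc m) * x\<rfloor> + 1) / real (Suc m))
      - F t \<omega> (real_of_int \<lfloor>real (Suc m) * x\<rfloor> / real (Suc m)))"
proof -
  define N where "N = real (Suc m)"
  define k where "k = \<lfloor>N * x\<rfloor>"
  have N: "N > 0" by (simp add: N_def)
  have sp: "\<omega>' \<in> space M" using \<omega>' by (simp add: grid_event_def)
  have close: "\<bar>F t \<omega>' (real_of_int i / N) - F t \<omega> (real_of_int i / N)\<bar> \<le> 1 / N"
    if "- (int (Suc m))\<^sup>2 \<le> i" "i \<le> (int (Suc m))\<^sup>2" for i
  proof -
    have "\<lfloor>N * F t \<omega>' (real_of_int i / N)\<rfloor> = \<lfloor>N * F t \<omega> (real_of_int i / N)\<rfloor>"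
      using \<omega>' that by (auto simp: grid_event_def grid_label_def N_def)
    then have "\<bar>N * F t \<omega>' (real_of_int i / N) - N * F t \<omega> (real_of_int i / N)\<bar> \<le> 1"
      by linarith
    then have "N * \<bar>F t \<omega>' (real_of_int i / N) - F t \<omega> (real_of_int i / N)\<bar> \<le> 1"
      using N by (simp add: right_diff_distrib[symmetric] abs_mult)
    then show ?thesis using N by (simp add: field_simps)
  qed
  have "\<bar>N * x\<bar> \<le> N * real m" using x N by (simp add: abs_mult mult_left_mono)
  moreover have "N * real m = N * N - N" by (simp add: N_def algebra_simps)
  ultimately have Nx: "\<bar>N * x\<bar> \<le> N * N - N" by simp
  have NN: "N * N = real_of_int ((int (Suc m))\<^sup>2)" by (simp add: N_def power2_eq_square)
  have N1: "N \<ge> 1" by (simp add: N_def)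
  have "- real_of_int ((int (Suc m))\<^sup>2) \<le> N * x" "N * x + 1 \<le> real_of_int ((int (Suc m))\<^sup>2)"
    using Nx N1 unfolding NN[symmetric] by linarith+
  then have k: "- (int (Suc m))\<^sup>2 \<le> k" "k + 1 \<le> (int (Suc m))\<^sup>2"
    unfolding k_def by linarith+
  have kx: "real_of_int k / N \<le> x" "x \<le> (real_of_int k + 1) / N"
    using N unfolding k_def by (auto simp: field_simps) linarith+
  have "\<bar>F t \<omega>' (real_of_int k / N) - F t \<omega> (real_of_int k / N)\<bar> \<le> 1 / N"
    using close[of k] k by linarith
  moreover have "\<bar>F t \<omega>' ((real_of_int k + 1) / N) - F t \<omega> ((real_of_int k + 1) / N)\<bar> \<le> 1 / N"
    using close[of "k + 1"] k by simp
  moreover have "F t \<omega>' (real_of_int k / N) \<le> F t \<omega>' x" "F t \<omega>' x \<le> F t \<omega>' ((real_of_int k + 1) / N)"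
    "F t \<omega> (real_of_int k / N) \<le> F t \<omega> x" "F t \<omega> x \<le> F t \<omega> ((real_of_int k + 1) / N)"
    using kx F_mono[OF sp] F_mono[OF \<omega>] by (auto dest: monoD)
  ultimately have "\<bar>F t \<omega>' x - F t \<omega> x\<bar> \<le> 1 / N + (F t \<omega> ((real_of_int k + 1) / N) - F t \<omega> (real_of_int k / N))"
    by linarith
  then show ?thesis by (simp add: N_def k_def)
qed

lemma floor_div_tendsto:
  fixes x :: real
  shows "(\<lambda>m. real_of_int \<lfloor>real (Suc m) * x\<rfloor> / real (Suc m)) \<longlonglongrightarrow> x"
    and "(\<lambda>m. (real_of_int \<lfloor>real (Suc m) * x\<rfloor> + 1) / real (Suc m)) \<longlonglongrightarrow> x"
proof -
  have 1: "(\<lambda>m. x - inverse (real (Suc m))) \<longlonglongrightarrow> x"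
    using tendsto_diff[OF tendsto_const LIMSEQ_inverse_real_of_nat, of x] by simp
  have le: "x - inverse (real (Suc m)) \<le> real_of_int \<lfloor>real (Suc m) * x\<rfloor> / real (Suc m)"
    "real_of_int \<lfloor>real (Suc m) * x\<rfloor> / real (Suc m) \<le> x" for m
  proof -
    define N where "N = real (Suc m)"
    have N: "0 < N" by (simp add: N_def)
    have "(x - inverse N) * N = N * x - 1"
      using N by (simp add: field_simps)
    also have "\<dots> \<le> real_of_int \<lfloor>N * x\<rfloor>" by linarith
    finally have "x - inverse N \<le> real_of_int \<lfloor>N * x\<rfloor> / N"
      using N by (simp only: pos_le_divide_eq)
    then show "x - inverse (real (Suc m)) \<le> real_of_int \<lfloor>real (Suc m) * x\<rfloor> / real (Suc m)"
      by (simp only: N_def)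
    have "real_of_int \<lfloor>N * x\<rfloor> \<le> x * N" unfolding mult.commute[of x] by linarith
    then have "real_of_int \<lfloor>N * x\<rfloor> / N \<le> x"
      using N by (simp only: pos_divide_le_eq)
    then show "real_of_int \<lfloor>real (Suc m) * x\<rfloor> / real (Suc m) \<le> x"
      by (simp only: N_def)
  qed
  show A: "(\<lambda>m. real_of_int \<lfloor>real (Suc m) * x\<rfloor> / real (Suc m)) \<longlonglongrightarrow> x"
    by (rule tendsto_sandwich[OF _ _ 1 tendsto_const]) (intro always_eventually allI le)+
  show "(\<lambda>m. (real_of_int \<lfloor>real (Suc m) * x\<rfloor> + 1) / real (Suc m)) \<longlonglongrightarrow> x"
    using tendsto_add[OF A LIMSEQ_inverse_real_of_nat]
    by (simp add: add_divide_distrib inverse_eq_divide del: of_nat_Suc)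
qed

text \<open>A path whose grid events all have positive probability is the limit in \<open>L\<^sup>2(\<mu>)\<close> of the
  conditional means of the process given those events. The conditional means converge at every
  continuity point of \<open>F t \<omega>\<close>, hence \<open>\<mu>\<close>-almost everywhere.\<close>

lemma dev_approximable:
  assumes \<omega>: "\<omega> \<in> space M" and pos: "\<And>m. 0 < measure M (grid_event t m \<omega>)"
  defines "Z \<equiv> \<lambda>m \<omega>'. indicator (grid_event t m \<omega>) \<omega>' / measure M (grid_event t m \<omega>)"
  shows "\<And>m. Z m \<in> borel_measurable M"
    and "\<And>m \<omega>'. \<bar>Z m \<omega>'\<bar> \<le> 1 / measure M (grid_event t m \<omega>)"
    and "(\<lambda>m. L2_norm \<mu> (\<lambda>x. pairing_adj t (Z m) x - dev t \<omega> x)) \<longlonglongrightarrow> 0"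
proof -
  have ev[measurable]: "grid_event t m \<omega> \<in> sets M" for m
    unfolding grid_event_def by (rule grid_label_measurable)
  show Z_meas[measurable]: "Z m \<in> borel_measurable M" for m
    unfolding Z_def by measurable
  show Z_bound: "\<bar>Z m \<omega>'\<bar> \<le> 1 / measure M (grid_event t m \<omega>)" for m \<omega>'
    by (auto simp: Z_def indicator_def)
  have Z_int: "integrable M (Z m)" for m
    by (rule bounded_integrable[OF Z_meas Z_bound])
  have Z_nonneg: "0 \<le> Z m \<omega>'" for m \<omega>' by (simp add: Z_def)
  have Z_mean: "(\<integral>\<omega>'. Z m \<omega>' \<partial>M) = 1" for m
    using pos[of m] ev[of m] by (simp add: Z_def sets.Int_space_eq2)
  have diff_le: "\<bar>pairing_adj t (Z m) x - dev t \<omega> x\<bar> \<le> d"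
    if d: "\<And>\<omega>'. \<omega>' \<in> grid_event t m \<omega> \<Longrightarrow> \<bar>F t \<omega>' x - F t \<omega> x\<bar> \<le> d" for m x d
  proof -
    have int: "integrable M (\<lambda>\<omega>'. dev t \<omega>' x * Z m \<omega>')"
      by (rule dev_mult_integrable[OF Z_meas Z_bound])
    have eq: "pairing_adj t (Z m) x - dev t \<omega> x = (\<integral>\<omega>'. dev t \<omega>' x * Z m \<omega>' - dev t \<omega> x * Z m \<omega>' \<partial>M)"
      using int Z_int by (simp add: pairing_adj_def Z_mean)
    have "\<bar>pairing_adj t (Z m) x - dev t \<omega> x\<bar>
        \<le> (\<integral>\<omega>'. \<bar>dev t \<omega>' x * Z m \<omega>' - dev t \<omega> x * Z m \<omega>'\<bar> \<partial>M)"
      unfolding eq by (rule integral_abs_bound)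
    also have "\<dots> \<le> (\<integral>\<omega>'. d * Z m \<omega>' \<partial>M)"
    proof (rule integral_mono)
      show "integrable M (\<lambda>\<omega>'. \<bar>dev t \<omega>' x * Z m \<omega>' - dev t \<omega> x * Z m \<omega>'\<bar>)"
        by (intro integrable_abs Bochner_Integration.integrable_diff integrable_mult_right int Z_int)
      show "integrable M (\<lambda>\<omega>'. d * Z m \<omega>')"
        by (intro integrable_mult_right Z_int)
      fix \<omega>'
      have "\<bar>dev t \<omega>' x * Z m \<omega>' - dev t \<omega> x * Z m \<omega>'\<bar> = \<bar>F t \<omega>' x - F t \<omega> x\<bar> * Z m \<omega>'"
        unfolding left_diff_distrib[symmetric] abs_mult abs_of_nonneg[OF Z_nonneg] by (simp add: dev_def)
      also have "\<dots> \<le> d * Z m \<omega>'"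
      proof (cases "\<omega>' \<in> grid_event t m \<omega>")
        case True
        then show ?thesis by (intro mult_right_mono d Z_nonneg)
      qed (simp add: Z_def)
      finally show "\<bar>dev t \<omega>' x * Z m \<omega>' - dev t \<omega> x * Z m \<omega>'\<bar> \<le> d * Z m \<omega>'" .
    qed
    finally show ?thesis by (simp add: Z_mean)
  qed
  show "(\<lambda>m. L2_norm \<mu> (\<lambda>x. pairing_adj t (Z m) x - dev t \<omega> x)) \<longlonglongrightarrow> 0"
  proof (rule L2_dominated_convergence(2)[where c=2])
    show "pairing_adj t (Z m) \<in> borel_measurable \<mu>" for m
      by (rule pairing_adj_measurable[OF Z_meas Z_bound])
    show "dev t \<omega> \<in> borel_measurable \<mu>" by (rule dev_path_measurable[OF \<omega>])
    show "\<bar>pairing_adj t (Z m) x\<bar> \<le> 2" for m x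
    proof -
      have "\<bar>F t \<omega>' x - F t \<omega> x\<bar> \<le> 1" if "\<omega>' \<in> grid_event t m \<omega>" for \<omega>'
      proof -
        have "\<omega>' \<in> space M" using that by (simp add: grid_event_def)
        then show ?thesis
          using F_nonneg[of \<omega> t x] F_le_1[of \<omega> t x] F_nonneg[of \<omega>' t x] F_le_1[of \<omega>' t x] \<omega> by simp
      qed
      from diff_le[of m x 1, OF this] dev_bound[OF \<omega>, of t x] show ?thesis by linarith
    qed
    have "(\<Union>x\<in>{x. \<not> isCont (F t \<omega>) x}. {x}) \<in> null_sets \<mu>"
      by (intro null_sets_UN' mono_ctble_discont[OF F_mono[OF \<omega>]] no_atoms)
    then have "AE x in \<mu>. isCont (F t \<omega>) x"
      by (rule AE_I') auto
    then show "AE x in \<mu>. (\<lambda>m. pairing_adj t (Z m) x) \<longlonglongrightarrow> dev t \<omega> x"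
    proof eventually_elim
      case (elim x)
      let ?d = "\<lambda>m. 1 / real (Suc m)
        + (F t \<omega> ((real_of_int \<lfloor>real (Suc m) * x\<rfloor> + 1) / real (Suc m))
          - F t \<omega> (real_of_int \<lfloor>real (Suc m) * x\<rfloor> / real (Suc m)))"
      have "?d \<longlonglongrightarrow> 0 + (F t \<omega> x - F t \<omega> x)"
        using LIMSEQ_inverse_real_of_nat unfolding inverse_eq_divide
        by (intro tendsto_add tendsto_diff isCont_tendsto_compose[OF elim] floor_div_tendsto)
      then have d0: "?d \<longlonglongrightarrow> 0" by simp
      obtain m0 :: nat where m0: "\<bar>x\<bar> \<le> real m0" using real_arch_simple by blast
      have "\<forall>\<^sub>F m in sequentially. norm (pairing_adj t (Z m) x - dev t \<omega> x) \<le> ?d m"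
        unfolding real_norm_def
      proof (intro eventually_sequentiallyI diff_le)
        fix m \<omega>' assume "m0 \<le> m" "\<omega>' \<in> grid_event t m \<omega>"
        then show "\<bar>F t \<omega>' x - F t \<omega> x\<bar> \<le> ?d m"
          using m0 by (intro grid_event_close \<omega>) auto
      qed
      from Lim_null_comparison[OF this d0] show ?case by (rule LIM_zero_cancel)
    qed
  qed
qed

lemma AE_dev_in_closure_range:
  assumes T: "\<And>u. u \<in> L2 \<mu> \<Longrightarrow> T u = pairing_adj t (pairing t u)"
    and eig: "eigen_sequence \<mu> T e \<phi>"
  shows "AE \<omega> in M. dev t \<omega> \<in> L2_closure \<mu> (T ` L2 \<mu>)"
proof -
  interpret T: compact_positive_op \<mu> T mass_root
    by (rule covariance_op_compact_positive[OF T])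
  interpret T: eigen_expansion \<mu> T mass_root e \<phi>
    by unfold_locales (rule eig)
  have sub: "T ` L2 \<mu> \<subseteq> L2 \<mu>" using T.T_L2 by auto
  have adj: "pairing_adj t Z \<in> L2_closure \<mu> (T ` L2 \<mu>)"
    if Z: "Z \<in> borel_measurable M" "\<And>\<omega>. \<bar>Z \<omega>\<bar> \<le> c" for Z c
  proof (rule T.in_closure_range)
    show "pairing_adj t Z \<in> L2 \<mu>" by (rule pairing_adj_L2[OF Z])
    show "(L2_inner \<mu> (pairing_adj t Z) u)\<^sup>2 \<le> c\<^sup>2 * L2_inner \<mu> (T u) u" if u: "u \<in> L2 \<mu>" for u
      unfolding T[OF u] by (rule pairing_adj_inner_power2_le[OF Z u])
  qed simp
  have closure: "dev t \<omega> \<in> L2_closure \<mu> (T ` L2 \<mu>)"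
    if \<omega>: "\<omega> \<in> space M" and pos: "\<forall>m. 0 < measure M (grid_event t m \<omega>)" for \<omega>
  proof -
    note approx = dev_approximable[OF \<omega> pos[rule_format]]
    show ?thesis
      by (rule L2_closure_limit[OF sub dev_L2[OF \<omega>] adj[OF approx(1,2)] approx(3)])
  qed
  from AE_grid_event_pos[of t] AE_space show ?thesis
    by eventually_elim (rule closure)
qed

end

section \<open>The sum of lagged covariance operators times their adjoints\<close>

context cdf_process
begin

lemma pairing_adj_pairing_add:
  assumes u: "u \<in> L2 \<mu>" and v: "v \<in> L2 \<mu>"
  shows "pairing_adj s (pairing t (\<lambda>x. u x + v x)) = (\<lambda>x. pairing_adj s (pairing t u) x + pairing_adj s (pairing t v) x)"
proof
  fix x
  have int: "integrable M (\<lambda>\<omega>. dev s \<omega> x * pairing t w \<omega>)" if w: "w \<in> L2 \<mu>" for w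
    by (rule dev_mult_integrable[OF pairing_measurable[OF w] pairing_bound[OF w]])
  have "pairing_adj s (pairing t (\<lambda>x. u x + v x)) x
    = (\<integral>\<omega>. dev s \<omega> x * pairing t u \<omega> + dev s \<omega> x * pairing t v \<omega> \<partial>M)"
    unfolding pairing_adj_def
    by (rule Bochner_Integration.integral_cong) (auto simp: pairing_add u v distrib_left)
  then show "pairing_adj s (pairing t (\<lambda>x. u x + v x)) x
    = pairing_adj s (pairing t u) x + pairing_adj s (pairing t v) x"
    using int[OF u] int[OF v] by (simp add: pairing_adj_def)
qed

lemma pairing_adj_scale: "pairing_adj s (\<lambda>\<omega>. c * Z \<omega>) x = c * pairing_adj s Z x"
  unfolding pairing_adj_def integral_mult_right_zero[symmetric] by (simp add: mult_ac)

lemma pairing_adj_pairing_L2: "u \<in> L2 \<mu> \<Longrightarrow> pairing_adj s (pairing t u) \<in> L2 \<mu>"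
  by (rule pairing_adj_L2[OF pairing_measurable pairing_bound])

lemma norm_pairing_adj_pairing_le:
  assumes u: "u \<in> L2 \<mu>"
  shows "L2_norm \<mu> (pairing_adj s (pairing t u)) \<le> mass_root * (mass_root * L2_norm \<mu> u)"
  by (rule norm_pairing_adj_le[OF pairing_measurable[OF u] pairing_bound[OF u]])
    (auto simp: mass_root_nonneg L2_norm_nonneg)

text \<open>The lag-\<open>k\<close> covariance operator is \<open>pairing_adj 0\<close> after \<open>pairing k\<close>, and its adjoint is
  \<open>pairing_adj k\<close> after \<open>pairing 0\<close>. Hence the sum over \<open>k \<in> I\<close> of the covariance operators times
  their adjoints is \<open>pairing_adj 0\<close> after \<open>lagged I\<close>.\<close>

definition lagged :: "nat set \<Rightarrow> (real \<Rightarrow> real) \<Rightarrow> 'a \<Rightarrow> real" where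
  "lagged I u \<omega> = (\<Sum>k\<in>I. pairing k (pairing_adj k (pairing 0 u)) \<omega>)"

lemma lagged_bound:
  assumes u: "u \<in> L2 \<mu>" and \<omega>: "\<omega> \<in> space M"
  shows "\<bar>lagged I u \<omega>\<bar> \<le> (real (card I) * mass_root ^ 3) * L2_norm \<mu> u"
proof -
  have "\<bar>pairing k (pairing_adj k (pairing 0 u)) \<omega>\<bar> \<le> mass_root ^ 3 * L2_norm \<mu> u" for k
  proof -
    have "\<bar>pairing k (pairing_adj k (pairing 0 u)) \<omega>\<bar> \<le> mass_root * L2_norm \<mu> (pairing_adj k (pairing 0 u))"
      by (rule pairing_bound[OF pairing_adj_pairing_L2[OF u] \<omega>])
    also have "\<dots> \<le> mass_root * (mass_root * (mass_root * L2_norm \<mu> u))"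
      by (intro mult_left_mono norm_pairing_adj_pairing_le u mass_root_nonneg)
    finally show ?thesis by (simp add: power3_eq_cube mult.assoc)
  qed
  then have "(\<Sum>k\<in>I. \<bar>pairing k (pairing_adj k (pairing 0 u)) \<omega>\<bar>) \<le> real (card I) * (mass_root ^ 3 * L2_norm \<mu> u)"
    by (rule sum_bounded_above)
  then show ?thesis
    unfolding lagged_def mult.assoc by (rule order_trans[OF sum_abs])
qed

lemma lagged_measurable: "u \<in> L2 \<mu> \<Longrightarrow> lagged I u \<in> borel_measurable M"
  unfolding lagged_def[abs_def] by (intro borel_measurable_sum pairing_measurable pairing_adj_pairing_L2)

lemma lagged_form:
  assumes u: "u \<in> L2 \<mu>" and v: "v \<in> L2 \<mu>"
  shows "L2_inner \<mu> (pairing_adj 0 (lagged I u)) v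
    = (\<Sum>k\<in>I. L2_inner \<mu> (pairing_adj k (pairing 0 v)) (pairing_adj k (pairing 0 u)))"
proof -
  have "L2_inner \<mu> (pairing_adj 0 (lagged I u)) v = (\<integral>\<omega>. lagged I u \<omega> * pairing 0 v \<omega> \<partial>M)"
    by (rule pairing_adjoint[OF lagged_measurable[OF u] lagged_bound[OF u] v, symmetric])
  also have "\<dots> = (\<integral>\<omega>. (\<Sum>k\<in>I. pairing 0 v \<omega> * pairing k (pairing_adj k (pairing 0 u)) \<omega>) \<partial>M)"
    by (simp add: lagged_def sum_distrib_left mult.commute)
  also have "\<dots> = (\<Sum>k\<in>I. \<integral>\<omega>. pairing 0 v \<omega> * pairing k (pairing_adj k (pairing 0 u)) \<omega> \<partial>M)"
    by (intro Bochner_Integration.integral_sum pairing_mult(1) v pairing_adj_pairing_L2 u)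
  also have "\<dots> = (\<Sum>k\<in>I. L2_inner \<mu> (pairing_adj k (pairing 0 v)) (pairing_adj k (pairing 0 u)))"
    by (intro sum.cong refl pairing_mult(2) v pairing_adj_pairing_L2 u)
  finally show ?thesis .
qed

lemma lagged_covariance_op_compact_positive:
  assumes T: "\<And>u. u \<in> L2 \<mu> \<Longrightarrow> T u = pairing_adj 0 (lagged I u)"
  shows "compact_positive_op \<mu> T (real (card I) * mass_root ^ 3)"
proof (rule compact_positive_opI[where Z="lagged I" and t=0])
  show "lagged I u \<in> borel_measurable M" if "u \<in> L2 \<mu>" for u
    by (rule lagged_measurable[OF that])
  show "\<bar>lagged I u \<omega>\<bar> \<le> real (card I) * mass_root ^ 3 * L2_norm \<mu> u" if "u \<in> L2 \<mu>" "\<omega> \<in> space M" for u \<omega>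
    by (rule lagged_bound[OF that])
  show "0 \<le> real (card I) * mass_root ^ 3" by (simp add: mass_root_nonneg)
  show "lagged I (\<lambda>x. u x + v x) \<omega> = lagged I u \<omega> + lagged I v \<omega>"
    if "u \<in> L2 \<mu>" "v \<in> L2 \<mu>" "\<omega> \<in> space M" for u v \<omega>
    using that by (simp add: lagged_def pairing_adj_pairing_add pairing_add pairing_adj_pairing_L2 sum.distrib)
  show "lagged I (\<lambda>x. a * u x) \<omega> = a * lagged I u \<omega>" for u a \<omega>
  proof -
    have "pairing_adj k (pairing 0 (\<lambda>x. a * u x)) = (\<lambda>x. a * pairing_adj k (pairing 0 u) x)" for k
      using pairing_adj_scale[of k a "pairing 0 u"] by (simp add: pairing_scale[abs_def] fun_eq_iff)
    then show ?thesis by (simp add: lagged_def pairing_scale sum_distrib_left)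
  qed
  show "T u = pairing_adj 0 (lagged I u)" if "u \<in> L2 \<mu>" for u by (rule T[OF that])
  show "L2_inner \<mu> (T u) v = L2_inner \<mu> u (T v)" if "u \<in> L2 \<mu>" "v \<in> L2 \<mu>" for u v
    using that by (simp add: T lagged_form L2_inner_commute[of u "pairing_adj 0 (lagged I v)"]
      L2_inner_commute[of "pairing_adj _ (pairing 0 v)" "pairing_adj _ (pairing 0 u)"])
  show "0 \<le> L2_inner \<mu> (T u) u" if "u \<in> L2 \<mu>" for u
    using that by (simp add: T lagged_form sum_nonneg L2_inner_self_nonneg)
qed

lemma lagged_covariance_kernel:
  fixes C :: "nat \<Rightarrow> real \<Rightarrow> real \<Rightarrow> real"
  defines "C \<equiv> \<lambda>k x y. \<integral>\<omega>. dev 0 \<omega> x * dev k \<omega> y \<partial>M"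
  assumes u: "u \<in> L2 \<mu>"
  shows "(\<integral>y. (\<Sum>k\<in>I. \<integral>z. C k x z * C k y z \<partial>\<mu>) * u y \<partial>\<mu>) = pairing_adj 0 (lagged I u) x"
proof -
  have C_meas[measurable]: "case_prod (C k) \<in> borel_measurable (\<mu> \<Otimes>\<^sub>M \<mu>)" for k
    unfolding C_def by measurable
  have C_section[measurable]: "C k y \<in> borel_measurable \<mu>" for k y
    using measurable_compose[OF measurable_Pair1' C_meas, of y k] by (simp add: space_mu)
  have C_bound: "\<bar>C k y z\<bar> \<le> 1" for k y z
    using pairing_adj_bound[of "\<lambda>\<omega>. dev k \<omega> z" 1 0 y] dev_bound by (simp add: C_def pairing_adj_def)
  have CC_bound: "\<bar>C k y z * C k y' z\<bar> \<le> 1" for k y y' z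
    using mult_mono[OF C_bound C_bound] by (simp add: abs_mult)
  have term_int: "integrable \<mu> (\<lambda>y. (\<integral>z. C k x z * C k y z \<partial>\<mu>) * u y)" for k
  proof (rule L2_bounded_mult[OF u])
    show "(\<lambda>y. \<integral>z. C k x z * C k y z \<partial>\<mu>) \<in> borel_measurable \<mu>" by measurable
    have "\<bar>\<integral>z. C k x z * C k y z \<partial>\<mu>\<bar> \<le> measure \<mu> (space \<mu>)" for y
    proof -
      have "\<bar>\<integral>z. C k x z * C k y z \<partial>\<mu>\<bar> \<le> (\<integral>z. \<bar>C k x z * C k y z\<bar> \<partial>\<mu>)"
        by (rule integral_abs_bound)
      also have "\<dots> \<le> (\<integral>z. 1 \<partial>\<mu>)"
      proof (rule integral_mono)
        show "integrable \<mu> (\<lambda>z. \<bar>C k x z * C k y z\<bar>)"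
          by (rule integrable_const_bound[where B=1]) (use CC_bound in \<open>auto intro!: AE_I2\<close>)
      qed (use CC_bound in auto)
      finally show ?thesis by simp
    qed
    then show "AE y in \<mu>. \<bar>\<integral>z. C k x z * C k y z \<partial>\<mu>\<bar> \<le> measure \<mu> (space \<mu>)"
      by (intro AE_I2)
  qed
  have term_eq: "(\<integral>y. (\<integral>z. C k x z * C k y z \<partial>\<mu>) * u y \<partial>\<mu>)
      = pairing_adj 0 (pairing k (pairing_adj k (pairing 0 u))) x" for k
  proof -
    have "(\<integral>y. (\<integral>z. C k x z * C k y z \<partial>\<mu>) * u y \<partial>\<mu>) = (\<integral>z. (\<integral>y. (C k x z * C k y z) * u y \<partial>\<mu>) \<partial>\<mu>)"
      by (rule Fubini_bounded[where c=1, symmetric])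
        (use finite_measure_axioms L2_integrable[OF u] CC_bound in auto)
    also have "\<dots> = (\<integral>z. C k x z * pairing_adj k (pairing 0 u) z \<partial>\<mu>)"
    proof (rule Bochner_Integration.integral_cong)
      fix z
      have "(\<integral>y. C k y z * u y \<partial>\<mu>) = pairing_adj k (pairing 0 u) z"
        using covariance_kernel[OF u, of k z 0] by (simp add: C_def mult.commute)
      then show "(\<integral>y. (C k x z * C k y z) * u y \<partial>\<mu>) = C k x z * pairing_adj k (pairing 0 u) z"
        by (simp add: mult.assoc)
    qed simp
    also have "\<dots> = pairing_adj 0 (pairing k (pairing_adj k (pairing 0 u))) x"
      unfolding C_def by (rule covariance_kernel[OF pairing_adj_pairing_L2[OF u]])
    finally show ?thesis .
  qed
  have "(\<integral>y. (\<Sum>k\<in>I. \<integral>z. C k x z * C k y z \<partial>\<mu>) * u y \<partial>\<mu>)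
    = (\<Sum>k\<in>I. \<integral>y. (\<integral>z. C k x z * C k y z \<partial>\<mu>) * u y \<partial>\<mu>)"
    unfolding sum_distrib_right by (rule Bochner_Integration.integral_sum[OF term_int])
  also have "\<dots> = (\<Sum>k\<in>I. pairing_adj 0 (pairing k (pairing_adj k (pairing 0 u))) x)"
    by (simp only: term_eq)
  also have "\<dots> = pairing_adj 0 (lagged I u) x"
  proof -
    have "integrable M (\<lambda>\<omega>. dev 0 \<omega> x * pairing k (pairing_adj k (pairing 0 u)) \<omega>)" for k
      by (rule dev_mult_integrable[OF pairing_measurable pairing_bound]) (rule pairing_adj_pairing_L2[OF u])+
    then show ?thesis
      unfolding pairing_adj_def[of 0 "lagged I u"] lagged_def sum_distrib_left
      by (subst Bochner_Integration.integral_sum) (auto simp: pairing_adj_def[of 0 "pairing _ _"])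
  qed
  finally show ?thesis .
qed

end

section \<open>Expansion of the random distribution functions\<close>

lemma diffraction_no_atoms:
  assumes "diffraction M \<xi> \<mu>"
  shows "{x} \<in> null_sets \<mu>"
proof -
  obtain I where I: "is_interval I" "absolutely_continuous (density lborel (indicator I)) \<mu>"
    using assms by (auto simp: diffraction_def)
  have "I \<in> sets borel" using I(1) by (rule real_interval_borel_measurable)
  then have "absolutely_continuous lborel (density lborel (indicator I))"
    by (intro absolutely_continuousI_density) simp
  moreover have "{x} \<in> null_sets lborel" by (simp add: null_sets_def)
  ultimately show ?thesis
    using I(2) unfolding absolutely_continuous_def by blast
qed

lemma stationary_cdf_process:
  fixes \<xi> :: "nat \<Rightarrow> 'a \<Rightarrow> real measure"
  assumes M: "prob_space M" and st: "stationary M weak_borel \<xi>" and diff: "diffraction M \<xi> \<mu>"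
  shows "cdf_process \<mu> M (\<lambda>t \<omega>. cdf (\<xi> t \<omega>)) (cdf (baricenter M (\<xi> 0)))"
proof -
  interpret M: prob_space M by fact
  have \<xi>: "random_measure M (\<xi> t)" for t
    using st M by (auto simp: random_measure_def random_measure_axioms_def stationary_def)
  interpret \<mu>: finite_borel_measure \<mu> using diff by (simp add: diffraction_def)
  have dist: "real_distribution (\<xi> t \<omega>)" if "\<omega> \<in> space M" for t \<omega>
    by (rule random_measure.real_distribution[OF \<xi> that])
  show ?thesis
  proof
    fix t \<omega> and x :: real
    show "sets \<mu> = sets borel" by (rule \<mu>.M_is_borel)
    show "{x} \<in> null_sets \<mu>" by (rule diffraction_no_atoms[OF diff])
    show "(\<lambda>(\<omega>, x). cdf (\<xi> t \<omega>) x) \<in> borel_measurable (M \<Otimes>\<^sub>M borel)"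
      by (rule random_measure.measurable_cdf_pair[OF \<xi>])
    have "(\<integral>\<omega>. cdf (\<xi> t \<omega>) x \<partial>M) = (\<integral>\<nu>. cdf \<nu> x \<partial>distr M weak_borel (\<xi> t))"
      by (rule integral_distr[symmetric, OF random_measure.measurable_weak[OF \<xi>] measurable_cdf_weak_borel])
    also have "\<dots> = (\<integral>\<omega>. cdf (\<xi> 0 \<omega>) x \<partial>M)"
      unfolding stationary_distr[OF M st, of t]
      by (rule integral_distr[OF random_measure.measurable_weak[OF \<xi>] measurable_cdf_weak_borel])
    finally show "(\<integral>\<omega>. cdf (\<xi> t \<omega>) x \<partial>M) = cdf (baricenter M (\<xi> 0)) x"
      by (simp add: random_measure.cdf_baricenter[OF \<xi>])
    assume \<omega>: "\<omega> \<in> space M"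
    interpret \<nu>: real_distribution "\<xi> t \<omega>" by (rule dist[OF \<omega>])
    show "mono (cdf (\<xi> t \<omega>))" by (rule monoI) (rule \<nu>.cdf_nondecreasing)
    show "continuous (at_right x) (cdf (\<xi> t \<omega>))" by (rule \<nu>.cdf_is_right_cont)
    show "0 \<le> cdf (\<xi> t \<omega>) x" by (rule \<nu>.cdf_nonneg)
    show "cdf (\<xi> t \<omega>) x \<le> 1" by (rule \<nu>.cdf_bounded_prob)
  qed
qed

theorem theorem3:
  fixes M :: "'a measure"
    and \<xi> :: "nat \<Rightarrow> 'a \<Rightarrow> real measure"
    and \<mu> :: "real measure"
    and p :: nat
    and lam \<theta> :: "nat \<Rightarrow> real"
    and \<phi> \<psi> :: "nat \<Rightarrow> real \<Rightarrow> real"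
    and F :: "nat \<Rightarrow> 'a \<Rightarrow> real \<Rightarrow> real"
    and EF0 :: "real \<Rightarrow> real"
    and W :: "nat \<Rightarrow> nat \<Rightarrow> 'a \<Rightarrow> real"
  assumes "prob_space M"
    and "stationary M weak_borel \<xi>"
    and "diffraction M \<xi> \<mu>"
    and "p \<ge> 1"
    and "eigen_sequence \<mu> (kernel_op \<mu> (autocov M \<xi> 0)) lam \<phi>"
    and "eigen_sequence \<mu> (kernel_op \<mu> (R_kernel M \<xi> \<mu> p)) \<theta> \<psi>"
    and "range_equivalent \<mu> (kernel_op \<mu> (R_kernel M \<xi> \<mu> p)) (kernel_op \<mu> (autocov M \<xi> 0))"
    and F_def: "\<And>t \<omega>. F t \<omega> = cdf (\<xi> t \<omega>)"
    and EF0_def: "EF0 = cdf (baricenter M (\<xi> 0))"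
    and W_def: "\<And>t j \<omega>. W t j \<omega> = L2_inner \<mu> (\<lambda>x. F t \<omega> x - EF0 x) (\<psi> j)"
  shows "(\<forall>t j. integrable M (W t j) \<and> prob_space.expectation M (W t j) = 0) \<and>
    (\<forall>t j. integrable M (\<lambda>\<omega>. (W t j \<omega>)\<^sup>2) \<and>
       (\<lambda>i. lam i * (L2_inner \<mu> (\<psi> j) (\<phi> i))\<^sup>2) sums prob_space.variance M (W t j)) \<and>
    (\<forall>j. \<theta> j \<noteq> 0 \<longrightarrow> (\<exists>B. AE x in \<mu>. \<bar>\<psi> j x\<bar> \<le> B)) \<and>
    (\<forall>t. AE \<omega> in M.
       (\<lambda>n. L2_norm \<mu> (\<lambda>x. F t \<omega> x - EF0 x - (\<Sum>j<n. W t j \<omega> * \<psi> j x))) \<longlonglongrightarrow> 0)"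
proof -
  interpret D: cdf_process \<mu> M F EF0
    unfolding F_def[abs_def] EF0_def by (rule stationary_cdf_process[OF assms(1-3)])
  have autocov_0: "autocov M \<xi> k x y = (\<integral>\<omega>. D.dev 0 \<omega> x * D.dev k \<omega> y \<partial>M)" for k x y
    using D.F_mean by (simp add: autocov_def covariance_def D.dev_def F_def[symmetric])
  have autocov_t: "autocov M \<xi> 0 x y = (\<integral>\<omega>. D.dev t \<omega> x * D.dev t \<omega> y \<partial>M)" for t x y
  proof -
    define H where "H = (\<lambda>\<nu>. (cdf \<nu> x - EF0 x) * (cdf \<nu> y - EF0 y))"
    have H: "H \<in> borel_measurable weak_borel"
      unfolding H_def using measurable_cdf_weak_borel[of x] measurable_cdf_weak_borel[of y] by measurable
    have "(\<integral>\<omega>. D.dev s \<omega> x * D.dev s \<omega> y \<partial>M) = (\<integral>\<nu>. H \<nu> \<partial>distr M weak_borel (\<xi> s))" for s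
    proof -
      have "\<xi> s \<in> measurable M weak_borel" using assms(2) by (simp add: stationary_def)
      from integral_distr[OF this H] show ?thesis by (simp add: H_def D.dev_def F_def)
    qed
    then show ?thesis
      by (simp add: autocov_0 stationary_distr[OF assms(1,2), of t])
  qed
  have C_op: "kernel_op \<mu> (autocov M \<xi> 0) u = D.pairing_adj t (D.pairing t u)" if "u \<in> L2 \<mu>" for t u
    using D.covariance_kernel[OF that] by (simp add: kernel_op_def autocov_t[of _ _ t] fun_eq_iff)
  have R_op: "kernel_op \<mu> (R_kernel M \<xi> \<mu> p) u = D.pairing_adj 0 (D.lagged {1..p} u)" if "u \<in> L2 \<mu>" for u
    using D.lagged_covariance_kernel[OF that]
    by (simp add: kernel_op_def R_kernel_def autocov_0 fun_eq_iff)
  interpret C: compact_positive_op \<mu> "kernel_op \<mu> (autocov M \<xi> 0)" D.mass_root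
    by (rule D.covariance_op_compact_positive[OF C_op])
  interpret C: eigen_expansion \<mu> "kernel_op \<mu> (autocov M \<xi> 0)" D.mass_root lam \<phi>
    by unfold_locales (rule assms(5))
  interpret R: compact_positive_op \<mu> "kernel_op \<mu> (R_kernel M \<xi> \<mu> p)" "real (card {1..p}) * D.mass_root ^ 3"
    by (rule D.lagged_covariance_op_compact_positive[OF R_op])
  interpret R: eigen_expansion \<mu> "kernel_op \<mu> (R_kernel M \<xi> \<mu> p)" "real (card {1..p}) * D.mass_root ^ 3" \<theta> \<psi>
    by unfold_locales (rule assms(6))
  have W: "W t j = D.pairing t (\<psi> j)" for t j
    by (simp add: fun_eq_iff W_def D.pairing_def L2_inner_def D.dev_def)
  have mean: "integrable M (W t j)" "(\<integral>\<omega>. W t j \<omega> \<partial>M) = 0" for t j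
    unfolding W by (rule D.pairing_mean[OF R.eigenfun_L2])+
  have var_int: "integrable M (\<lambda>\<omega>. (W t j \<omega>)\<^sup>2)" for t j
    using D.pairing_mult(1)[OF R.eigenfun_L2 R.eigenfun_L2] by (simp add: W power2_eq_square)
  have var_sums: "(\<lambda>i. lam i * (L2_inner \<mu> (\<psi> j) (\<phi> i))\<^sup>2) sums (\<integral>\<omega>. (W t j \<omega>)\<^sup>2 \<partial>M)" for t j
  proof -
    have "(\<integral>\<omega>. (W t j \<omega>)\<^sup>2 \<partial>M) = L2_inner \<mu> (kernel_op \<mu> (autocov M \<xi> 0) (\<psi> j)) (\<psi> j)"
      using D.pairing_mult(2)[OF R.eigenfun_L2 R.eigenfun_L2, of t j t j] C_op[OF R.eigenfun_L2, of j t]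
      by (simp add: W power2_eq_square)
    then show ?thesis using C.inner_T_eigen_sum[OF R.eigenfun_L2, of j] by simp
  qed
  have expansion: "AE \<omega> in M. (\<lambda>n. L2_norm \<mu> (\<lambda>x. F t \<omega> x - EF0 x - (\<Sum>j<n. W t j \<omega> * \<psi> j x))) \<longlonglongrightarrow> 0" for t
  proof -
    have "AE \<omega> in M. D.dev t \<omega> \<in> L2_closure \<mu> (kernel_op \<mu> (autocov M \<xi> 0) ` L2 \<mu>)"
      by (rule D.AE_dev_in_closure_range[OF C_op assms(5)])
    then show ?thesis
    proof eventually_elim
      case (elim \<omega>)
      then have "D.dev t \<omega> \<in> L2_closure \<mu> (kernel_op \<mu> (R_kernel M \<xi> \<mu> p) ` L2 \<mu>)"
        using assms(7) by (simp add: range_equivalent_def)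
      from R.remainder_tendsto_0[OF this] show ?case
        by (simp add: D.fourier_remainder_def D.dev_def[abs_def] W_def)
    qed
  qed
  show ?thesis
    using mean var_int var_sums expansion R.eigenfun_bounded by simp
qed

end
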